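(* Let $V$ be a symplectic vector space over $\mathbb{C}$ (finite-dimensional) and $n\ge 1$. Let $S_{n+1}$ act on $V^n\cong\mathbb{C}^n\otimes V$, where $\mathbb{C}^n$ is the reflection representation of $S_{n+1}$ and $V$ is regarded as a trivial representation. Then $HP_0(\mathcal{O}_{V^n/S_{n+1}})^*\cong\mathbb{C}$, and it is spanned by (the restriction to $\mathcal{O}_{V^n/S_{n+1}}=\mathcal{O}_{V^n}^{S_{n+1}}$ of) the augmentation map $\mathcal{O}_{V^n}\to\mathbb{C}$, i.e. evaluation at the origin.
   Context: For a Poisson algebra $A$, $HP_0(A):=A/\{A,A\}$, and $HP_0(A)^*$ is its vector space dual. $\mathcal{O}_X$ denotes the algebra of regular functions on an affine variety $X$. The space $\mathbb{C}^n\otimes V$ is identified with the subspace $\{(v_1,\dots,v_{n+1})\in V^{n+1}:\sum_i v_i=0\}$, with $S_{n+1}$ permuting components; it carries the induced ($S_{n+1}$-invariant) symplectic form, so that $\mathcal{O}_{V^n}^{S_{n+1}}$ is a Poisson algebra. *)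

theory Defs
  imports
    "HOL-Analysis.Analysis"
    "HOL-Combinatorics.Permutations"
    "HOL-Library.Function_Algebras"
    "HOL-Library.Set_Algebras"
begin

text \<open>
  Subspaces \<open>E\<close> of an ambient complex vector space (a type together with its scalar
  multiplication) carry all structures below.  A complex-valued function on a carrier \<open>E\<close> is
  represented by its extension by \<open>0\<close> outside \<open>E\<close>, so that functions on \<open>E\<close>
  are equal iff they agree on \<open>E\<close>.  Addition and multiplication of functions are pointwise.
\<close>

definition fun_scale :: "(complex \<Rightarrow> 'b \<Rightarrow> 'b) \<Rightarrow> complex \<Rightarrow> ('i \<Rightarrow> 'b) \<Rightarrow> 'i \<Rightarrow> 'b" where
  "fun_scale s c v = (\<lambda>i. s c (v i))"

definition dual_space :: "(complex \<Rightarrow> 'e \<Rightarrow> 'e) \<Rightarrow> 'e::plus set \<Rightarrow> ('e \<Rightarrow> complex) set" where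
  "dual_space s E = {\<alpha>. (\<forall>x\<in>E. \<forall>y\<in>E. \<alpha> (x + y) = \<alpha> x + \<alpha> y) \<and>
     (\<forall>c. \<forall>x\<in>E. \<alpha> (s c x) = c * \<alpha> x) \<and> (\<forall>x. x \<notin> E \<longrightarrow> \<alpha> x = 0)}"

definition symplectic_form ::
    "(complex \<Rightarrow> 'v \<Rightarrow> 'v) \<Rightarrow> ('v::ab_group_add \<Rightarrow> 'v \<Rightarrow> complex) \<Rightarrow> bool" where
  "symplectic_form s \<omega> \<longleftrightarrow>
     (\<forall>x. Vector_Spaces.linear s (*) (\<omega> x)) \<and>
     (\<forall>y. Vector_Spaces.linear s (*) (\<lambda>x. \<omega> x y)) \<and>
     (\<forall>x. \<omega> x x = 0) \<and>
     (\<forall>x. (\<forall>y. \<omega> x y = 0) \<longrightarrow> x = 0)"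

subsection \<open>Regular functions and the Poisson bracket of a symplectic vector space\<close>

text \<open>Over \<open>\<complex>\<close>, the coordinate ring of a finite-dimensional space \<open>E\<close> is the algebra of
  functions on \<open>E\<close> generated by the constants and the linear functionals.\<close>

inductive_set regular_functions ::
    "(complex \<Rightarrow> 'e \<Rightarrow> 'e) \<Rightarrow> 'e::plus set \<Rightarrow> ('e \<Rightarrow> complex) set"
  for s :: "complex \<Rightarrow> 'e \<Rightarrow> 'e" and E :: "'e set" where
  const: "(\<lambda>x. if x \<in> E then c else 0) \<in> regular_functions s E"
| linear: "\<alpha> \<in> dual_space s E \<Longrightarrow> \<alpha> \<in> regular_functions s E"
| add: "f \<in> regular_functions s E \<Longrightarrow> g \<in> regular_functions s E \<Longrightarrow> f + g \<in> regular_functions s E"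
| mult: "f \<in> regular_functions s E \<Longrightarrow> g \<in> regular_functions s E \<Longrightarrow> f * g \<in> regular_functions s E"

text \<open>The differential of \<open>f\<close> at \<open>x\<close>, evaluated on the tangent vector \<open>w\<close>.\<close>

definition differential ::
    "(complex \<Rightarrow> 'e \<Rightarrow> 'e) \<Rightarrow> ('e::plus \<Rightarrow> complex) \<Rightarrow> 'e \<Rightarrow> 'e \<Rightarrow> complex" where
  "differential s f x w = deriv (\<lambda>t. f (x + s t w)) 0"

text \<open>For a form \<open>\<Omega>\<close> that is nondegenerate on the finite-dimensional space \<open>E\<close>, the
  vector below exists and is unique for every regular \<open>f\<close> and every \<open>x\<close> in \<open>E\<close>.\<close>

definition hamiltonian_vector ::
    "(complex \<Rightarrow> 'e \<Rightarrow> 'e) \<Rightarrow> 'e::plus set \<Rightarrow> ('e \<Rightarrow> 'e \<Rightarrow> complex) \<Rightarrow> ('e \<Rightarrow> complex) \<Rightarrow> 'e \<Rightarrow> 'e" where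
  "hamiltonian_vector s E \<Omega> f x = (THE u. u \<in> E \<and> (\<forall>w\<in>E. \<Omega> u w = differential s f x w))"

definition poisson_bracket ::
    "(complex \<Rightarrow> 'e \<Rightarrow> 'e) \<Rightarrow> 'e::plus set \<Rightarrow> ('e \<Rightarrow> 'e \<Rightarrow> complex) \<Rightarrow>
     ('e \<Rightarrow> complex) \<Rightarrow> ('e \<Rightarrow> complex) \<Rightarrow> 'e \<Rightarrow> complex" where
  "poisson_bracket s E \<Omega> f g =
     (\<lambda>x. if x \<in> E then \<Omega> (hamiltonian_vector s E \<Omega> f x) (hamiltonian_vector s E \<Omega> g x) else 0)"

subsection \<open>Zeroth Poisson homology\<close>

text \<open>\<open>A\<close> is the carrier of a Poisson algebra with scalar multiplication \<open>s\<close> and bracket \<open>br\<close>.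
  The quotient by the linear span of all brackets consists of cosets, which are added as sets;
  in the scalar multiplication, adding the subspace takes care of the scalar \<open>0\<close>.\<close>

definition bracket_span ::
    "(complex \<Rightarrow> 'a \<Rightarrow> 'a) \<Rightarrow> 'a::ab_group_add set \<Rightarrow> ('a \<Rightarrow> 'a \<Rightarrow> 'a) \<Rightarrow> 'a set" where
  "bracket_span s A br = module.span s {br f g |f g. f \<in> A \<and> g \<in> A}"

definition HP0 ::
    "(complex \<Rightarrow> 'a \<Rightarrow> 'a) \<Rightarrow> 'a::ab_group_add set \<Rightarrow> ('a \<Rightarrow> 'a \<Rightarrow> 'a) \<Rightarrow> 'a set set" where
  "HP0 s A br = (\<lambda>a. a +o bracket_span s A br) ` A"

definition HP0_scale ::
    "(complex \<Rightarrow> 'a \<Rightarrow> 'a) \<Rightarrow> 'a::ab_group_add set \<Rightarrow> ('a \<Rightarrow> 'a \<Rightarrow> 'a) \<Rightarrow> complex \<Rightarrow> 'a set \<Rightarrow> 'a set" where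
  "HP0_scale s A br c X = s c ` X + bracket_span s A br"

definition HP0_dual ::
    "(complex \<Rightarrow> 'a \<Rightarrow> 'a) \<Rightarrow> 'a::ab_group_add set \<Rightarrow> ('a \<Rightarrow> 'a \<Rightarrow> 'a) \<Rightarrow> ('a set \<Rightarrow> complex) set" where
  "HP0_dual s A br = dual_space (HP0_scale s A br) (HP0 s A br)"

subsection \<open>The representation of the symmetric group\<close>

text \<open>\<open>(n+1)\<close>-tuples are families indexed by \<open>{1..n+1}\<close>, extended by \<open>0\<close>.\<close>

definition refl_tensor :: "nat \<Rightarrow> (nat \<Rightarrow> 'v::ab_group_add) set" where
  "refl_tensor n = {v. (\<forall>i. i \<notin> {1..n+1} \<longrightarrow> v i = 0) \<and> (\<Sum>i\<in>{1..n+1}. v i) = 0}"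

definition tuple_form ::
    "('v \<Rightarrow> 'v \<Rightarrow> complex) \<Rightarrow> nat \<Rightarrow> (nat \<Rightarrow> 'v) \<Rightarrow> (nat \<Rightarrow> 'v) \<Rightarrow> complex" where
  "tuple_form \<omega> n v w = (\<Sum>i\<in>{1..n+1}. \<omega> (v i) (w i))"

definition perm_action :: "(nat \<Rightarrow> nat) \<Rightarrow> (nat \<Rightarrow> 'v) \<Rightarrow> nat \<Rightarrow> 'v" where
  "perm_action \<sigma> v = (\<lambda>i. v (inv \<sigma> i))"

definition invariant_functions ::
    "(complex \<Rightarrow> 'v \<Rightarrow> 'v) \<Rightarrow> nat \<Rightarrow> ((nat \<Rightarrow> 'v::ab_group_add) \<Rightarrow> complex) set" where
  "invariant_functions s n =
     {f \<in> regular_functions (fun_scale s) (refl_tensor n).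
        \<forall>\<sigma>. \<sigma> permutes {1..n+1} \<longrightarrow> (\<forall>v\<in>refl_tensor n. f (perm_action \<sigma> v) = f v)}"

definition refl_bracket ::
    "(complex \<Rightarrow> 'v \<Rightarrow> 'v) \<Rightarrow> ('v::ab_group_add \<Rightarrow> 'v \<Rightarrow> complex) \<Rightarrow> nat \<Rightarrow>
     ((nat \<Rightarrow> 'v) \<Rightarrow> complex) \<Rightarrow> ((nat \<Rightarrow> 'v) \<Rightarrow> complex) \<Rightarrow> (nat \<Rightarrow> 'v) \<Rightarrow> complex" where
  "refl_bracket s \<omega> n = poisson_bracket (fun_scale s) (refl_tensor n) (tuple_form \<omega> n)"

abbreviation HP0_quotient_dual ::
    "(complex \<Rightarrow> 'v \<Rightarrow> 'v) \<Rightarrow> ('v::ab_group_add \<Rightarrow> 'v \<Rightarrow> complex) \<Rightarrow> nat \<Rightarrow>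
     (((nat \<Rightarrow> 'v) \<Rightarrow> complex) set \<Rightarrow> complex) set" where
  "HP0_quotient_dual s \<omega> n \<equiv>
     HP0_dual (fun_scale (*)) (invariant_functions s n) (refl_bracket s \<omega> n)"

abbreviation HP0_class ::
    "(complex \<Rightarrow> 'v \<Rightarrow> 'v) \<Rightarrow> ('v::ab_group_add \<Rightarrow> 'v \<Rightarrow> complex) \<Rightarrow> nat \<Rightarrow>
     ((nat \<Rightarrow> 'v) \<Rightarrow> complex) \<Rightarrow> ((nat \<Rightarrow> 'v) \<Rightarrow> complex) set" where
  "HP0_class s \<omega> n f \<equiv>
     f +o bracket_span (fun_scale (*)) (invariant_functions s n) (refl_bracket s \<omega> n)"

end

theory Submission
  imports Defs
begin

text \<open>
  Evaluation at the origin kills all brackets, because the differential at \<open>0\<close> of an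
  invariant function is an invariant vector of \<open>refl_tensor n\<close>, hence zero.

  Conversely, let \<open>\<Phi>\<close> be a linear functional on the invariants that kills all brackets, and
  let \<open>\<phi> \<xi>\<close> be its value on the symmetrization of the \<open>d\<close>-th power of the linear form
  \<open>\<Omega> \<xi>\<close>.  The brackets of the power sums \<open>\<Sum>j. \<omega> \<eta> (v j) ^ (k + 1)\<close> with such symmetrized powers,
  combined with binomial weights, give
  \<open>(\<Sum>j. \<omega> \<eta> (\<zeta> j) * \<phi> (\<zeta> + \<eta> e\<^sub>j)) = 0\<close> whenever \<open>\<Sum>j. \<zeta> j\<close> is a multiple of \<open>\<eta>\<close>.
  Fix \<open>a \<noteq> 0\<close> and let \<open>c\<close> be the value of \<open>\<phi>\<close> at the tuple whose first \<open>n\<close>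
  components are \<open>a\<close>.  Induction on the number of components that differ from \<open>a\<close> shows that
  \<open>\<phi>\<close> equals \<open>c\<close> on \<open>refl_tensor n\<close>: in the relation for the tuple with one such component
  \<open>b\<close> replaced by \<open>a\<close> and \<open>\<eta> = b - a\<close>, every term is known to be \<open>c\<close> or is, by symmetry of
  \<open>\<phi>\<close>, the wanted value.  Hence \<open>\<phi> \<xi> = \<phi> 0 = 0\<close> for \<open>d > 0\<close>, and powers of
  linear forms span the regular functions.
\<close>

lemma vector_space_fun_scale:
  "vector_space (fun_scale (*) :: complex \<Rightarrow> ('i \<Rightarrow> complex) \<Rightarrow> 'i \<Rightarrow> complex)"
  by standard (auto simp: fun_scale_def fun_eq_iff algebra_simps)

definition single :: "nat \<Rightarrow> 'v \<Rightarrow> nat \<Rightarrow> 'v::zero" where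
  "single i x = (\<lambda>j. if j = i then x else 0)"

locale symplectic_space = finite_dimensional_vector_space scale Basis
  for scale :: "complex \<Rightarrow> 'v::ab_group_add \<Rightarrow> 'v" and Basis :: "'v set" +
  fixes \<omega> :: "'v \<Rightarrow> 'v \<Rightarrow> complex" and n :: nat
  assumes symplectic: "symplectic_form scale \<omega>"
begin

abbreviation I :: "nat set" where "I \<equiv> {1..n+1}"
abbreviation E :: "(nat \<Rightarrow> 'v) set" where "E \<equiv> refl_tensor n"
abbreviation \<Omega> :: "(nat \<Rightarrow> 'v) \<Rightarrow> (nat \<Rightarrow> 'v) \<Rightarrow> complex" where "\<Omega> \<equiv> tuple_form \<omega> n"
abbreviation smul :: "complex \<Rightarrow> (nat \<Rightarrow> 'v) \<Rightarrow> nat \<Rightarrow> 'v" where "smul \<equiv> fun_scale scale"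
abbreviation regular :: "((nat \<Rightarrow> 'v) \<Rightarrow> complex) set" where
  "regular \<equiv> regular_functions smul E"
abbreviation \<A> :: "((nat \<Rightarrow> 'v) \<Rightarrow> complex) set" where "\<A> \<equiv> invariant_functions scale n"
abbreviation \<B> :: "((nat \<Rightarrow> 'v) \<Rightarrow> complex) set" where
  "\<B> \<equiv> bracket_span (fun_scale (*)) \<A> (refl_bracket scale \<omega> n)"
abbreviation perms :: "(nat \<Rightarrow> nat) set" where "perms \<equiv> {\<sigma>. \<sigma> permutes I}"

declare sum.cl_ivl_Suc [simp del]

subsection \<open>Bilinear algebra\<close>

lemma omega_lin: "Vector_Spaces.linear scale (*) (\<omega> x)" "Vector_Spaces.linear scale (*) (\<lambda>x. \<omega> x y)"
  using symplectic by (auto simp: symplectic_form_def)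

lemma omega_add [simp]: "\<omega> x (y + z) = \<omega> x y + \<omega> x z" "\<omega> (x + y) z = \<omega> x z + \<omega> y z"
  using omega_lin by (auto simp: Vector_Spaces.linear_iff)

lemma omega_scale [simp]: "\<omega> x (scale c y) = c * \<omega> x y" "\<omega> (scale c x) y = c * \<omega> x y"
  using omega_lin by (auto simp: Vector_Spaces.linear_iff)

lemma omega_zero [simp]: "\<omega> x 0 = 0" "\<omega> 0 x = 0" "\<omega> x x = 0"
  using omega_scale(1)[of x 0 0] omega_scale(2)[of 0 0 x] symplectic
  by (auto simp: symplectic_form_def)

lemma omega_skew: "\<omega> y x = - \<omega> x y"
proof -
  have "\<omega> y x + \<omega> x y = 0"
    using omega_zero(3)[of "x + y"] unfolding omega_add by (simp add: add.commute)
  then show ?thesis by (simp add: eq_neg_iff_add_eq_0)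
qed

lemma omega_minus [simp]: "\<omega> x (- y) = - \<omega> x y" "\<omega> (- x) y = - \<omega> x y"
  using omega_scale(1)[of x "-1" y] omega_scale(2)[of "-1" x y] by auto

lemma omega_diff [simp]: "\<omega> x (y - z) = \<omega> x y - \<omega> x z" "\<omega> (x - y) z = \<omega> x z - \<omega> y z"
  using omega_add(1)[of x y "-z"] omega_add(2)[of x "-y" z] by auto

lemma omega_sum: "\<omega> x (\<Sum>i\<in>F. f i) = (\<Sum>i\<in>F. \<omega> x (f i))" "\<omega> (\<Sum>i\<in>F. f i) x = (\<Sum>i\<in>F. \<omega> (f i) x)"
  by (induction F rule: infinite_finite_induct) auto

lemma omega_nondegenerate: "(\<And>y. \<omega> x y = 0) \<Longrightarrow> x = 0"
  using symplectic by (auto simp: symplectic_form_def)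

text \<open>Recording a functional by its values on \<open>Basis\<close> turns
  \<open>\<omega>\<close> into an endomorphism \<open>T\<close> of the space itself. Nondegeneracy
  makes \<open>T\<close> injective, and finite dimension then makes it surjective.\<close>

lemma omega_riesz:
  assumes "Vector_Spaces.linear scale (*) \<alpha>"
  obtains x where "\<And>y. \<omega> x y = \<alpha> y"
proof -
  define T where "T x = (\<Sum>b\<in>Basis. scale (\<omega> x b) b)" for x
  have lin: "Vector_Spaces.linear scale scale T"
    by (auto simp: Vector_Spaces.linear_iff T_def scale_left_distrib sum.distrib scale_sum_right vector_space_axioms)
  have ext: "f y = g y" if "Vector_Spaces.linear scale (*) f" "Vector_Spaces.linear scale (*) g"
    "\<And>b. b \<in> Basis \<Longrightarrow> f b = g b" for f g y
  proof -
    interpret f: Vector_Spaces.linear scale "(*)" f by fact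
    interpret g: Vector_Spaces.linear scale "(*)" g by fact
    obtain c where "y = (\<Sum>b\<in>Basis. scale (c b) b)"
      using span_Basis span_finite[OF finite_Basis] by auto
    then show ?thesis
      by (simp add: f.sum g.sum f.scale g.scale that(3))
  qed
  have coeff: "f b = g b" if "(\<Sum>b\<in>Basis. scale (f b) b) = (\<Sum>b\<in>Basis. scale (g b) b)" "b \<in> Basis" for f g b
  proof -
    have "(\<Sum>b\<in>Basis. scale (f b - g b) b) = 0"
      using that(1) by (simp add: scale_left_diff_distrib sum_subtractf)
    then have "f b - g b = 0"
      using independent_Basis[unfolded independent_explicit_finite_subsets, rule_format, OF subset_refl finite_Basis,
          of "\<lambda>b. f b - g b" b] that(2) by simp
    then show ?thesis by simp
  qed
  interpret T: Vector_Spaces.linear scale scale T by fact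
  have "inj T"
  proof (subst T.inj_iff_eq_0, intro allI impI)
    fix x assume "T x = 0"
    then have "(\<Sum>b\<in>Basis. scale (\<omega> x b) b) = (\<Sum>b\<in>Basis. scale 0 b)"
      by (simp add: T_def)
    then have "\<omega> x b = 0" if "b \<in> Basis" for b
      using coeff[of "\<omega> x" "\<lambda>_. 0"] that by blast
    moreover have "Vector_Spaces.linear scale (*) (\<lambda>_. 0 :: complex)"
      using vector_space_axioms vector_space_over_itself.vector_space_axioms
      by (simp add: Vector_Spaces.linear_iff)
    ultimately have "\<omega> x y = 0" for y
      using ext[OF omega_lin(1), of "\<lambda>_. 0"] by blast
    then show "x = 0" by (rule omega_nondegenerate)
  qed
  then have "surj T"
    by (rule linear_inj_imp_surj[OF lin])
  then obtain x where "T x = (\<Sum>b\<in>Basis. scale (\<alpha> b) b)"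
    by (metis surjD)
  then have "\<omega> x b = \<alpha> b" if "b \<in> Basis" for b
    using coeff[of "\<omega> x" \<alpha>] that by (auto simp: T_def)
  then show thesis
    using ext[OF omega_lin(1) assms] that by blast
qed

section \<open>The form on tuples and on the zero-sum subspace\<close>

lemma tuple_form_add [simp]: "\<Omega> u (v + w) = \<Omega> u v + \<Omega> u w" "\<Omega> (u + v) w = \<Omega> u w + \<Omega> v w"
  by (auto simp: tuple_form_def sum.distrib)

lemma tuple_form_scale [simp]: "\<Omega> u (smul c v) = c * \<Omega> u v" "\<Omega> (smul c u) v = c * \<Omega> u v"
  by (auto simp: tuple_form_def fun_scale_def sum_distrib_left)

lemma tuple_form_zero [simp]: "\<Omega> u 0 = 0" "\<Omega> 0 u = 0"
  by (auto simp: tuple_form_def)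

lemma tuple_form_skew: "\<Omega> v u = - \<Omega> u v"
  unfolding tuple_form_def sum_negf[symmetric] by (intro sum.cong refl omega_skew)

lemma tuple_form_single [simp]: "i \<in> I \<Longrightarrow> \<Omega> u (single i x) = \<omega> (u i) x" "i \<in> I \<Longrightarrow> \<Omega> (single i x) u = \<omega> x (u i)"
  by (auto simp: tuple_form_def single_def if_distrib if_distribR sum.delta cong: if_cong)

lemma E_zero [simp]: "0 \<in> E" by (simp add: refl_tensor_def)

lemma E_add: "u \<in> E \<Longrightarrow> v \<in> E \<Longrightarrow> u + v \<in> E"
  by (simp add: refl_tensor_def sum.distrib)

lemma E_scale: "u \<in> E \<Longrightarrow> smul c u \<in> E"
  by (simp add: refl_tensor_def fun_scale_def flip: scale_sum_right)

lemma perm_E: "\<sigma> permutes I \<Longrightarrow> u \<in> E \<Longrightarrow> perm_action \<sigma> u \<in> E"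
proof -
  assume \<sigma>: "\<sigma> permutes I" and u: "u \<in> E"
  have "(\<Sum>i\<in>I. u (inv \<sigma> i)) = (\<Sum>i\<in>I. u i)"
    using sum.permute[OF permutes_inv[OF \<sigma>], of u] by (simp add: o_def)
  moreover have "u (inv \<sigma> i) = 0" if "i \<notin> I" for i
    using permutes_not_in[OF permutes_inv[OF \<sigma>] that] that u by (auto simp: refl_tensor_def)
  ultimately show ?thesis using u by (simp add: refl_tensor_def perm_action_def)
qed

lemma perm_perm:
  assumes "\<sigma> permutes I" "\<tau> permutes I"
  shows "perm_action \<sigma> (perm_action \<tau> v) = perm_action (\<sigma> \<circ> \<tau>) v"
  using assms by (simp add: perm_action_def fun_eq_iff o_inv_distrib permutes_bij)

lemma perm_inv_cancel: "\<sigma> permutes I \<Longrightarrow> perm_action (inv \<sigma>) (perm_action \<sigma> v) = v"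
  by (simp add: perm_action_def fun_eq_iff permutes_inv_inv permutes_inverses)

lemma perm_E_iff: "\<sigma> permutes I \<Longrightarrow> perm_action \<sigma> u \<in> E \<longleftrightarrow> u \<in> E"
  by (metis perm_E perm_inv_cancel permutes_inv)

lemma perm_add: "perm_action \<sigma> (u + v) = perm_action \<sigma> u + perm_action \<sigma> v"
  and perm_scale: "perm_action \<sigma> (smul c v) = smul c (perm_action \<sigma> v)"
  by (auto simp: perm_action_def fun_scale_def)

lemma tuple_form_perm:
  assumes "\<sigma> permutes I"
  shows "\<Omega> (perm_action \<sigma> u) (perm_action \<sigma> v) = \<Omega> u v"
  using sum.permute[OF permutes_inv[OF assms], of "\<lambda>i. \<omega> (u i) (v i)"]
  by (simp add: tuple_form_def perm_action_def o_def)

text \<open>Projection onto \<open>E\<close> by removing the mean. Tuples that are constant on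
  \<open>I\<close> are orthogonal to \<open>E\<close> for \<open>\<Omega>\<close>, so pairings with
  elements of \<open>E\<close> do not see the correction.\<close>

definition center :: "(nat \<Rightarrow> 'v) \<Rightarrow> nat \<Rightarrow> 'v" where
  "center w = (\<lambda>i. if i \<in> I then w i - scale (1 / of_nat (n+1)) (\<Sum>j\<in>I. w j) else 0)"

lemma center_E: "center w \<in> E"
proof -
  have "(\<Sum>i\<in>I. center w i) = (\<Sum>i\<in>I. w i) - (\<Sum>i\<in>I. scale (1 / of_nat (n+1)) (\<Sum>j\<in>I. w j))"
    by (simp add: center_def sum_subtractf)
  also have "(\<Sum>i\<in>I. scale (1 / of_nat (n+1)) (\<Sum>j\<in>I. w j)) = scale (\<Sum>i\<in>I. 1 / of_nat (n+1)) (\<Sum>j\<in>I. w j)"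
    by (rule scale_sum_left[symmetric])
  also have "(\<Sum>i\<in>I. 1 / of_nat (n+1)) = (1::complex)"
    by (simp del: of_nat_Suc of_nat_add)
  finally show ?thesis by (simp add: refl_tensor_def center_def)
qed

lemma center_id: "w \<in> E \<Longrightarrow> center w = w"
  by (auto simp: center_def refl_tensor_def fun_eq_iff)

lemma center_add: "center (u + v) = center u + center v"
  by (auto simp: center_def fun_eq_iff sum.distrib scale_right_distrib)

lemma center_scale: "center (smul c u) = smul c (center u)"
  by (auto simp: center_def fun_scale_def fun_eq_iff scale_right_diff_distrib scale_sum_right mult.commute)

text \<open>For \<open>u\<close> in \<open>E\<close> the last term is zero. It is kept for later
  tuples outside \<open>E\<close> whose sum merely pairs to zero with the mean of
  \<open>w\<close>.\<close>

lemma tuple_form_center_right: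
  "\<Omega> u (center w) = \<Omega> u w - \<omega> (\<Sum>i\<in>I. u i) (scale (1 / of_nat (n+1)) (\<Sum>j\<in>I. w j))"
  by (simp add: tuple_form_def center_def omega_sum(2) sum_subtractf del: omega_scale of_nat_Suc of_nat_add)

lemma tuple_form_center_left: "w \<in> E \<Longrightarrow> \<Omega> (center u) w = \<Omega> u w"
  by (subst (1 2) tuple_form_skew) (simp add: tuple_form_center_right, simp add: refl_tensor_def)

lemma perm_center:
  assumes "\<sigma> permutes I"
  shows "perm_action \<sigma> (center w) = center (perm_action \<sigma> w)"
  using sum.permute[OF permutes_inv[OF assms], of w] permutes_in_image[OF permutes_inv[OF assms]]
  by (auto simp: perm_action_def center_def fun_eq_iff o_def)

lemma tuple_form_nondegenerate:
  assumes "u \<in> E" "\<And>w. w \<in> E \<Longrightarrow> \<Omega> u w = 0"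
  shows "u = 0"
proof
  fix i
  show "u i = 0 i"
  proof (cases "i \<in> I")
    case True
    have "\<omega> (u i) x = 0" for x
      using assms(2)[OF center_E, of "single i x"] assms(1) True
      by (simp add: tuple_form_center_right refl_tensor_def)
    then show ?thesis using omega_nondegenerate by auto
  qed (use assms(1) in \<open>auto simp: refl_tensor_def\<close>)
qed

text \<open>As \<open>\<alpha>\<close> is linear only on \<open>E\<close>, each slot is probed
  through \<open>center (single i y)\<close> and represented by \<open>omega_riesz\<close>.
  Centering the tuple found this way leaves its pairing with \<open>E\<close> unchanged.\<close>

lemma tuple_form_riesz:
  assumes "\<alpha> \<in> dual_space smul E"
  obtains \<xi> where "\<xi> \<in> E" "\<And>v. v \<in> E \<Longrightarrow> \<alpha> v = \<Omega> \<xi> v"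
proof -
  have add: "\<alpha> (u + v) = \<alpha> u + \<alpha> v" if "u \<in> E" "v \<in> E" for u v
    using assms that by (auto simp: dual_space_def)
  have scale: "\<alpha> (smul c u) = c * \<alpha> u" if "u \<in> E" for u c
    using assms that by (auto simp: dual_space_def)
  have "\<exists>x. \<forall>y. \<omega> x y = \<alpha> (center (single i y))" for i
  proof -
    have "single i (x + y) = single i x + single i y" "single i (scale c x) = smul c (single i x)" for x y c
      by (auto simp: single_def fun_eq_iff fun_scale_def)
    then have "Vector_Spaces.linear scale (*) (\<lambda>y. \<alpha> (center (single i y)))"
      by (intro Vector_Spaces.linear_iff[THEN iffD2] conjI allI)
         (auto simp: center_add center_scale add scale center_E vector_space_axioms vector_space_over_itself.vector_space_axioms)
    then show ?thesis using omega_riesz by metis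
  qed
  then obtain \<xi> where \<xi>: "\<And>i y. \<omega> (\<xi> i) y = \<alpha> (center (single i y))" by metis
  \<comment> \<open>Membership in \<open>E\<close> is carried along because additivity of
    \<open>\<alpha>\<close> is available only there.\<close>
  have sum: "\<alpha> (\<Sum>i\<in>F. center (f i)) = (\<Sum>i\<in>F. \<alpha> (center (f i))) \<and> (\<Sum>i\<in>F. center (f i)) \<in> E"
    if "finite F" for F and f :: "nat \<Rightarrow> nat \<Rightarrow> 'v"
    using that
  proof (induction F rule: finite_induct)
    case empty
    show ?case using scale[of 0 0] E_zero by (simp add: fun_scale_def zero_fun_def)
  next
    case (insert x F)
    then show ?case
      using add[OF center_E, of "\<Sum>i\<in>F. center (f i)" "f x"] E_add[OF center_E, of "\<Sum>i\<in>F. center (f i)" "f x"]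
      by (simp only: sum.insert[OF insert.hyps(1,2)])
  qed
  have csum: "center (\<Sum>i\<in>F. f i) = (\<Sum>i\<in>F. center (f i))" for F and f :: "nat \<Rightarrow> nat \<Rightarrow> 'v"
    using center_id[OF E_zero] by (induction F rule: infinite_finite_induct) (simp_all add: center_add del: plus_fun_def zero_fun_def)
  have sum_at: "(\<Sum>i\<in>F. f i) j = (\<Sum>i\<in>F. f i j)" for F j and f :: "nat \<Rightarrow> nat \<Rightarrow> 'v"
    by (induction F rule: infinite_finite_induct) auto
  show thesis
  proof (rule that[of "center \<xi>"])
    fix v assume v: "v \<in> E"
    have "v = (\<Sum>i\<in>I. single i (v i))"
      using v by (auto simp: fun_eq_iff single_def refl_tensor_def sum_at)
    then have "\<alpha> v = \<alpha> (\<Sum>i\<in>I. center (single i (v i)))"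
      using center_id[OF v] csum by metis
    also have "\<dots> = \<Omega> \<xi> v"
      using sum[of I] by (simp add: tuple_form_def \<xi>)
    finally show "\<alpha> v = \<Omega> (center \<xi>) v"
      using v by (simp add: tuple_form_center_left)
  qed (rule center_E)
qed

subsection \<open>Hamiltonian vectors\<close>

lemma sum_fun_at: "(\<Sum>i\<in>F. f i) x = (\<Sum>i\<in>F. f i x)" for f :: "'i \<Rightarrow> 'j \<Rightarrow> complex"
  by (induction F rule: infinite_finite_induct) auto

lemma regular_outside: "f \<in> regular \<Longrightarrow> x \<notin> E \<Longrightarrow> f x = 0"
  by (induction rule: regular_functions.induct) (auto simp: dual_space_def)

lemma regular_zero: "0 \<in> regular"
  using regular_functions.const[of E 0 smul] by (simp add: zero_fun_def)

lemma regular_sum: "(\<And>i. i \<in> F \<Longrightarrow> f i \<in> regular) \<Longrightarrow> (\<Sum>i\<in>F. f i) \<in> regular"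
  by (induction F rule: infinite_finite_induct) (auto intro: regular_zero regular_functions.add simp del: plus_fun_apply)

lemma regular_scale:
  assumes "f \<in> regular"
  shows "fun_scale (*) c f \<in> regular"
proof -
  have "fun_scale (*) c f = (\<lambda>x. if x \<in> E then c else 0) * f"
    using regular_outside[OF assms] by (auto simp: fun_scale_def fun_eq_iff)
  then show ?thesis
    using regular_functions.mult[OF regular_functions.const assms] by simp
qed

text \<open>Relational counterpart of \<open>hamiltonian_vector\<close>. It asserts
  differentiability, whereas \<open>deriv\<close> and \<open>THE\<close> denote something even when
  no derivative or no unique vector exists, and it can be built up along the generation of regular
  functions.\<close>

definition hamiltonian_at :: "((nat \<Rightarrow> 'v) \<Rightarrow> complex) \<Rightarrow> (nat \<Rightarrow> 'v) \<Rightarrow> (nat \<Rightarrow> 'v) \<Rightarrow> bool" where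
  "hamiltonian_at f x u \<longleftrightarrow> u \<in> E \<and>
     (\<forall>w\<in>E. ((\<lambda>t. f (x + smul t w)) has_field_derivative \<Omega> u w) (at 0))"

lemma smul_0 [simp]: "smul 0 w = 0"
  by (auto simp: fun_scale_def)

lemma hamiltonian_at_exists:
  assumes "f \<in> regular" "x \<in> E"
  shows "\<exists>u. hamiltonian_at f x u"
  using assms(1)
proof (induction rule: regular_functions.induct)
  case (const c)
  have "hamiltonian_at (\<lambda>x. if x \<in> E then c else 0) x 0"
    using assms(2) by (auto simp: hamiltonian_at_def E_add E_scale simp del: plus_fun_apply)
  then show ?case by blast
next
  case (linear \<alpha>)
  obtain \<xi> where \<xi>: "\<xi> \<in> E" "\<And>v. v \<in> E \<Longrightarrow> \<alpha> v = \<Omega> \<xi> v"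
    using tuple_form_riesz[OF linear] by blast
  have "((\<lambda>t. \<Omega> \<xi> x + t * \<Omega> \<xi> w) has_field_derivative \<Omega> \<xi> w) (at 0)" for w
    by (auto intro!: derivative_eq_intros)
  then have "hamiltonian_at \<alpha> x \<xi>"
    using assms(2) \<xi> by (simp add: hamiltonian_at_def E_add E_scale del: plus_fun_apply)
  then show ?case by blast
next
  case (add f g)
  then obtain u v where uv: "hamiltonian_at f x u" "hamiltonian_at g x v" by blast
  have "hamiltonian_at (f + g) x (u + v)"
    using uv by (auto simp: hamiltonian_at_def intro!: E_add DERIV_add)
  then show ?case by blast
next
  case (mult f g)
  then obtain u v where uv: "hamiltonian_at f x u" "hamiltonian_at g x v" by blast
  have "hamiltonian_at (f * g) x (smul (g x) u + smul (f x) v)"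
    using uv unfolding hamiltonian_at_def
    by (auto intro!: E_add E_scale derivative_eq_intros)
  then show ?case by blast
qed

lemma hamiltonian_vector_eqI:
  assumes "hamiltonian_at f x u"
  shows "hamiltonian_vector smul E \<Omega> f x = u"
  unfolding hamiltonian_vector_def
proof (rule the_equality)
  have diff: "differential smul f x w = \<Omega> u w" if "w \<in> E" for w
    using assms that unfolding differential_def hamiltonian_at_def by (blast intro: DERIV_imp_deriv)
  then show "u \<in> E \<and> (\<forall>w\<in>E. \<Omega> u w = differential smul f x w)"
    using assms by (simp add: hamiltonian_at_def)
  fix v assume v: "v \<in> E \<and> (\<forall>w\<in>E. \<Omega> v w = differential smul f x w)"
  have "v + smul (-1) u = 0"
    using v diff assms by (intro tuple_form_nondegenerate E_add E_scale) (auto simp: hamiltonian_at_def)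
  then show "v = u"
    by (auto simp: fun_scale_def fun_eq_iff)
qed

text \<open>Along the Hamiltonian vector \<open>u\<close> of \<open>f\<close>, the derivative of
  \<open>g\<close> is \<open>\<Omega> v u\<close> with \<open>v\<close> the Hamiltonian vector of
  \<open>g\<close>; the sign is the skew symmetry of \<open>\<Omega>\<close>. Thus \<open>v\<close>
  never has to be computed.\<close>

lemma refl_bracket_eqI:
  assumes "hamiltonian_at f x u" "g \<in> regular" "x \<in> E"
    and "((\<lambda>t. g (x + smul t u)) has_field_derivative D) (at 0)"
  shows "refl_bracket scale \<omega> n f g x = - D"
proof -
  obtain v where v: "hamiltonian_at g x v"
    using hamiltonian_at_exists assms(2,3) by blast
  then have "\<Omega> v u = D"
    using assms(1,4) by (auto simp: hamiltonian_at_def intro: DERIV_unique)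
  then show ?thesis
    using assms(1,3) v tuple_form_skew[of u v]
    by (simp add: refl_bracket_def poisson_bracket_def hamiltonian_vector_eqI)
qed

subsection \<open>Invariant functions\<close>

lemma invariantI:
  assumes "f \<in> regular" "\<And>\<sigma> v. \<sigma> permutes I \<Longrightarrow> v \<in> E \<Longrightarrow> f (perm_action \<sigma> v) = f v"
  shows "f \<in> \<A>"
  using assms by (simp add: invariant_functions_def)

lemma invariantD:
  assumes "f \<in> \<A>"
  shows "f \<in> regular" "\<sigma> permutes I \<Longrightarrow> v \<in> E \<Longrightarrow> f (perm_action \<sigma> v) = f v"
  using assms by (simp_all add: invariant_functions_def)

lemma invariant_add: "f \<in> \<A> \<Longrightarrow> g \<in> \<A> \<Longrightarrow> f + g \<in> \<A>"
  using regular_functions.add[of f smul E g] by (simp add: invariant_functions_def)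

lemma invariant_scale: "f \<in> \<A> \<Longrightarrow> fun_scale (*) c f \<in> \<A>"
  using regular_scale[of f c] by (simp add: invariant_functions_def fun_scale_def[of _ _ f])

lemma invariant_zero: "0 \<in> \<A>"
  by (rule invariantI) (auto intro: regular_zero)

definition const :: "complex \<Rightarrow> (nat \<Rightarrow> 'v) \<Rightarrow> complex" where
  "const c = (\<lambda>v. if v \<in> E then c else 0)"

lemma invariant_const: "const c \<in> \<A>"
  by (rule invariantI) (auto simp: const_def perm_E intro: regular_functions.const)

lemma bracket_zero_at_origin:
  assumes "f \<in> \<A>" "g \<in> \<A>"
  shows "refl_bracket scale \<omega> n f g 0 = 0"
proof -
  obtain u where u: "hamiltonian_at f 0 u"
    using hamiltonian_at_exists assms invariantD(1) E_zero by blast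
  have perm_u: "perm_action \<sigma> u = u" if \<sigma>: "\<sigma> permutes I" for \<sigma>
  proof -
    have "\<Omega> (perm_action \<sigma> u) w = \<Omega> u w" if "w \<in> E" for w
    proof (rule DERIV_unique)
      \<comment> \<open>Pulling the direction back by \<open>\<sigma>\<close> turns invariance of
        \<open>f\<close> along the line into invariance of \<open>u\<close>.\<close>
      define w' where "w' = perm_action (inv \<sigma>) w"
      have w': "w' \<in> E" "perm_action \<sigma> w' = w"
        using perm_E[OF permutes_inv[OF \<sigma>] that] perm_inv_cancel[OF permutes_inv[OF \<sigma>], of w] \<sigma>
        by (simp_all add: w'_def permutes_inv_inv)
      show "((\<lambda>t. f (0 + smul t w)) has_field_derivative \<Omega> u w) (at 0)"
        using u that by (auto simp: hamiltonian_at_def)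
      have "((\<lambda>t. f (0 + smul t w')) has_field_derivative \<Omega> u w') (at 0)"
        using u w' by (auto simp: hamiltonian_at_def)
      moreover have "\<Omega> u w' = \<Omega> (perm_action \<sigma> u) w"
        using tuple_form_perm[OF \<sigma>, of u w'] w' by simp
      moreover have "f (smul t w') = f (smul t w)" for t
        using invariantD(2)[OF assms(1) \<sigma> E_scale[OF w'(1)]] w' by (simp add: perm_scale)
      ultimately show "((\<lambda>t. f (0 + smul t w)) has_field_derivative \<Omega> (perm_action \<sigma> u) w) (at 0)"
        by (simp only: add_0_left)
    qed
    then have "perm_action \<sigma> u + smul (-1) u = 0"
      using u \<sigma> by (intro tuple_form_nondegenerate E_add E_scale perm_E) (auto simp: hamiltonian_at_def)
    then show ?thesis by (auto simp: fun_scale_def fun_eq_iff)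
  qed
  \<comment> \<open>Invariance under the transposition of \<open>i\<close> and
    \<open>j\<close>.\<close>
  have eq: "u i = u j" if "i \<in> I" "j \<in> I" for i j
    using fun_cong[OF perm_u[OF permutes_swap_id[OF that]], of j] by (simp add: perm_action_def)
  have "u i = 0" for i
  proof (cases "i \<in> I")
    case True
    have "0 = (\<Sum>j\<in>I. u j)" using u by (simp add: hamiltonian_at_def refl_tensor_def)
    \<comment> \<open>The form \<open>scale 1\<close> lets the sum be collected into one multiple of
      \<open>u i\<close>, with the nonzero scalar n + 1.\<close>
    also have "\<dots> = (\<Sum>j\<in>I. scale 1 (u i))" 
    proof (rule sum.cong[OF refl])
      fix j assume "j \<in> I"
      then have "u j = u i" using True by (rule eq)
      then show "u j = scale 1 (u i)" by simp
    qed
    also have "\<dots> = scale (\<Sum>j\<in>I. 1) (u i)" by (rule scale_sum_left[symmetric])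
    finally show ?thesis by (simp add: of_nat_eq_0_iff flip: of_nat_Suc)
  qed (use u in \<open>auto simp: hamiltonian_at_def refl_tensor_def\<close>)
  then have "u = 0" by (simp add: fun_eq_iff)
  then show ?thesis
    using u by (simp add: refl_bracket_def poisson_bracket_def hamiltonian_vector_eqI)
qed

subsection \<open>Symmetrization and the bracket identity\<close>

text \<open>Left without division by (n+1)!, so it multiplies invariants by that factor, which
  returns in \<open>defect\<close>.\<close>

definition sym :: "((nat \<Rightarrow> 'v) \<Rightarrow> complex) \<Rightarrow> (nat \<Rightarrow> 'v) \<Rightarrow> complex" where
  "sym f = (\<lambda>v. \<Sum>\<sigma>\<in>perms. f (perm_action \<sigma> v))"

definition lin_power :: "(nat \<Rightarrow> 'v) \<Rightarrow> nat \<Rightarrow> (nat \<Rightarrow> 'v) \<Rightarrow> complex" where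
  "lin_power \<xi> d = (\<lambda>v. if v \<in> E then \<Omega> \<xi> v ^ d else 0)"

definition power_sum :: "'v \<Rightarrow> nat \<Rightarrow> (nat \<Rightarrow> 'v) \<Rightarrow> complex" where
  "power_sum \<eta> d = (\<lambda>v. if v \<in> E then \<Sum>j\<in>I. \<omega> \<eta> (v j) ^ d else 0)"

lemma lin_power_0: "lin_power \<xi> 0 = const 1"
  by (auto simp: lin_power_def const_def)

lemma lin_power_Suc: "lin_power \<xi> (Suc d) = lin_power \<xi> 1 * lin_power \<xi> d"
  by (auto simp: lin_power_def fun_eq_iff)

lemma regular_lin_power: "lin_power \<xi> d \<in> regular"
proof (induction d)
  case 0
  then show ?case by (simp add: lin_power_0 const_def regular_functions.const)
next
  case (Suc d)
  have "lin_power \<xi> 1 \<in> dual_space smul E"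
    by (auto simp: lin_power_def dual_space_def E_add E_scale simp del: plus_fun_apply)
  then show ?case
    using Suc regular_functions.linear regular_functions.mult lin_power_Suc by metis
qed

lemma regular_perm:
  assumes \<sigma>: "\<sigma> permutes I" and f: "f \<in> regular"
  shows "(\<lambda>v. f (perm_action \<sigma> v)) \<in> regular"
  using f
proof (induction rule: regular_functions.induct)
  case (const c)
  then show ?case using regular_functions.const[of E c] perm_E_iff[OF \<sigma>] by simp
next
  case (linear \<alpha>)
  then show ?case
    by (intro regular_functions.linear)
       (auto simp: dual_space_def perm_add perm_scale perm_E[OF \<sigma>] perm_E_iff[OF \<sigma>] simp del: plus_fun_apply)
next
  case (add f g)
  then show ?case using regular_functions.add by (fastforce simp: plus_fun_def)
next
  case (mult f g)
  then show ?case using regular_functions.mult by (fastforce simp: times_fun_def)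
qed

lemma sym_invariant:
  assumes "f \<in> regular"
  shows "sym f \<in> \<A>"
proof (rule invariantI)
  have "sym f = (\<Sum>\<sigma>\<in>perms. (\<lambda>v. f (perm_action \<sigma> v)))"
    by (simp add: sym_def fun_eq_iff sum_fun_at)
  moreover have "(\<Sum>\<sigma>\<in>perms. (\<lambda>v. f (perm_action \<sigma> v))) \<in> regular"
    using assms by (intro regular_sum regular_perm) simp_all
  ultimately show "sym f \<in> regular" by simp
  fix \<tau> v assume \<tau>: "\<tau> permutes I"
  have "sym f (perm_action \<tau> v) = (\<Sum>\<sigma>\<in>perms. f (perm_action (\<sigma> \<circ> \<tau>) v))"
    unfolding sym_def using \<tau> by (intro sum.cong refl) (simp add: perm_perm)
  also have "\<dots> = sym f v"
    unfolding sym_def by (rule sum_permutations_compose_right[OF \<tau>, symmetric])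
  finally show "sym f (perm_action \<tau> v) = sym f v" .
qed

lemma sym_perm:
  assumes \<tau>: "\<tau> permutes I"
  shows "sym (\<lambda>v. f (perm_action \<tau> v)) = sym f"
proof
  fix v
  have "sym (\<lambda>v. f (perm_action \<tau> v)) v = (\<Sum>\<sigma>\<in>perms. f (perm_action (\<tau> \<circ> \<sigma>) v))"
    unfolding sym_def using \<tau> by (intro sum.cong refl) (simp add: perm_perm)
  also have "\<dots> = sym f v"
    unfolding sym_def by (rule setum_permutations_compose_left[OF \<tau>, symmetric])
  finally show "sym (\<lambda>v. f (perm_action \<tau> v)) v = sym f v" .
qed

lemma sym_invariant_eq:
  assumes "f \<in> \<A>"
  shows "sym f = fun_scale (*) (of_nat (fact (n+1))) f"
proof
  fix v
  have "f (perm_action \<sigma> v) = f v" if "\<sigma> permutes I" for \<sigma>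
    using invariantD(2)[OF assms that, of v] regular_outside[OF invariantD(1)[OF assms]] perm_E_iff[OF that]
    by metis
  then have "sym f v = (\<Sum>\<sigma>\<in>perms. f v)"
    unfolding sym_def by (intro sum.cong) auto
  moreover have "card perms = fact (n+1)"
    by (rule card_permutations) simp_all
  ultimately show "sym f v = fun_scale (*) (of_nat (fact (n+1))) f v"
    by (simp only: fun_scale_def sum_constant)
qed

lemma sym_add: "sym (f + g) = sym f + sym g"
  and sym_scale: "sym (fun_scale (*) c f) = fun_scale (*) c (sym f)"
  by (auto simp: sym_def fun_eq_iff sum.distrib fun_scale_def sum_distrib_left)

lemma sym_sum: "sym (\<Sum>i\<in>F. f i) = (\<Sum>i\<in>F. sym (f i))"
  by (auto simp: sym_def fun_eq_iff sum_fun_at intro: sum.swap)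

lemma regular_power_sum: "power_sum \<eta> d \<in> regular"
proof -
  have "power_sum \<eta> d = (\<Sum>j\<in>I. lin_power (single j \<eta>) d)"
    by (auto simp: power_sum_def lin_power_def fun_eq_iff sum_fun_at intro!: sum.cong)
  then show ?thesis by (simp add: regular_sum regular_lin_power)
qed

lemma power_sum_invariant: "power_sum \<eta> d \<in> \<A>"
proof (rule invariantI[OF regular_power_sum])
  fix \<sigma> v assume "\<sigma> permutes I" "v \<in> E"
  then show "power_sum \<eta> d (perm_action \<sigma> v) = power_sum \<eta> d v"
    using sum.permute[OF permutes_inv, of \<sigma> I "\<lambda>i. \<omega> \<eta> (v i) ^ d"] perm_E
    by (simp add: power_sum_def perm_action_def o_def)
qed

text \<open>The tuple inside \<open>center\<close> represents the differential on all tuples;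
  projecting it to \<open>E\<close> keeps its pairings with tangent vectors of
  \<open>E\<close>.\<close>

lemma hamiltonian_power_sum:
  assumes "v \<in> E"
  shows "hamiltonian_at (power_sum \<eta> (Suc k)) v
    (center (\<lambda>j. scale (of_nat (Suc k) * \<omega> \<eta> (v j) ^ k) \<eta>))"
  unfolding hamiltonian_at_def
proof (intro conjI ballI center_E)
  fix w assume w: "w \<in> E"
  have "((\<lambda>t. \<Sum>j\<in>I. (\<omega> \<eta> (v j) + t * \<omega> \<eta> (w j)) ^ Suc k) has_field_derivative
      (\<Sum>j\<in>I. of_nat (Suc k) * \<omega> \<eta> (v j) ^ k * \<omega> \<eta> (w j))) (at 0)"
    by (rule DERIV_sum) (auto intro!: derivative_eq_intros simp del: power_Suc of_nat_Suc)
  moreover have "power_sum \<eta> (Suc k) (v + smul t w) = (\<Sum>j\<in>I. (\<omega> \<eta> (v j) + t * \<omega> \<eta> (w j)) ^ Suc k)" for t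
    using E_add[OF assms E_scale[OF w]] by (simp add: power_sum_def fun_scale_def del: power_Suc)
  moreover have "\<Omega> (center (\<lambda>j. scale (of_nat (Suc k) * \<omega> \<eta> (v j) ^ k) \<eta>)) w =
      (\<Sum>j\<in>I. of_nat (Suc k) * \<omega> \<eta> (v j) ^ k * \<omega> \<eta> (w j))"
    unfolding tuple_form_center_left[OF w] by (simp add: tuple_form_def del: of_nat_Suc)
  ultimately show "((\<lambda>t. power_sum \<eta> (Suc k) (v + smul t w)) has_field_derivative
      \<Omega> (center (\<lambda>j. scale (of_nat (Suc k) * \<omega> \<eta> (v j) ^ k) \<eta>)) w) (at 0)"
    by (simp del: power_Suc of_nat_Suc plus_fun_apply)
qed

text \<open>The symmetrized power is differentiated along the Hamiltonian vector of the power sum.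
  Centering that vector subtracts a multiple of \<open>\<eta>\<close> from every slot, which
  \<open>\<Omega> \<zeta>\<close> does not see by the hypothesis on \<open>\<zeta>\<close>.\<close>

lemma bracket_power_sum:
  assumes v: "v \<in> E" and \<zeta>: "\<omega> \<eta> (\<Sum>i\<in>I. \<zeta> i) = 0"
  shows "refl_bracket scale \<omega> n (power_sum \<eta> (Suc k)) (sym (lin_power \<zeta> (Suc l))) v =
    of_nat (Suc k) * of_nat (Suc l) *
    (\<Sum>j\<in>I. \<omega> \<eta> (\<zeta> j) * (\<Sum>\<sigma>\<in>perms. \<omega> \<eta> (perm_action \<sigma> v j) ^ k * \<Omega> \<zeta> (perm_action \<sigma> v) ^ l))"
    (is "_ = ?R")
proof -
  define u where "u = center (\<lambda>j. scale (of_nat (Suc k) * \<omega> \<eta> (v j) ^ k) \<eta>)"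
  have u: "u \<in> E" by (simp add: u_def center_E)
  have \<Omega>u: "\<Omega> \<zeta> (perm_action \<sigma> u) = - of_nat (Suc k) * (\<Sum>j\<in>I. \<omega> \<eta> (\<zeta> j) * \<omega> \<eta> (perm_action \<sigma> v j) ^ k)"
    if \<sigma>: "\<sigma> permutes I" for \<sigma>
  proof -
    have "\<omega> (\<Sum>i\<in>I. \<zeta> i) \<eta> = 0" using \<zeta> omega_skew[of "\<Sum>i\<in>I. \<zeta> i" \<eta>] by simp
    then have mean: "\<omega> (\<Sum>i\<in>I. \<zeta> i) (scale (1 / of_nat (n+1)) (\<Sum>j\<in>I. scale (c j) \<eta>)) = 0" for c
      by (simp only: omega_sum(1) omega_scale) simp
    have "perm_action \<sigma> u = center (\<lambda>j. scale (of_nat (Suc k) * \<omega> \<eta> (perm_action \<sigma> v j) ^ k) \<eta>)"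
      unfolding u_def perm_center[OF \<sigma>] by (simp only: perm_action_def)
    then have "\<Omega> \<zeta> (perm_action \<sigma> u) = \<Omega> \<zeta> (\<lambda>j. scale (of_nat (Suc k) * \<omega> \<eta> (perm_action \<sigma> v j) ^ k) \<eta>)"
      by (simp only: tuple_form_center_right mean diff_zero)
    also have "\<dots> = (\<Sum>j\<in>I. of_nat (Suc k) * \<omega> \<eta> (perm_action \<sigma> v j) ^ k * \<omega> (\<zeta> j) \<eta>)"
      by (simp add: tuple_form_def)
    \<comment> \<open>The sign from skew symmetry will cancel the one in
      \<open>refl_bracket_eqI\<close>.\<close>
    also have "\<dots> = (\<Sum>j\<in>I. - of_nat (Suc k) * (\<omega> \<eta> (\<zeta> j) * \<omega> \<eta> (perm_action \<sigma> v j) ^ k))"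
    proof (rule sum.cong[OF refl])
      fix j
      have "\<omega> (\<zeta> j) \<eta> = - \<omega> \<eta> (\<zeta> j)" by (rule omega_skew)
      then show "of_nat (Suc k) * \<omega> \<eta> (perm_action \<sigma> v j) ^ k * \<omega> (\<zeta> j) \<eta> =
          - of_nat (Suc k) * (\<omega> \<eta> (\<zeta> j) * \<omega> \<eta> (perm_action \<sigma> v j) ^ k)"
        by (simp del: of_nat_Suc)
    qed
    finally show ?thesis by (simp only: sum_distrib_left)
  qed
  have *: "((\<lambda>t. \<Sum>\<sigma>\<in>perms. (\<Omega> \<zeta> (perm_action \<sigma> v) + t * \<Omega> \<zeta> (perm_action \<sigma> u)) ^ Suc l) has_field_derivative
      (\<Sum>\<sigma>\<in>perms. of_nat (Suc l) * \<Omega> \<zeta> (perm_action \<sigma> v) ^ l * \<Omega> \<zeta> (perm_action \<sigma> u))) (at 0)"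
    by (rule DERIV_sum) (auto intro!: derivative_eq_intros simp del: power_Suc of_nat_Suc)
  have **: "sym (lin_power \<zeta> (Suc l)) (v + smul t u) =
      (\<Sum>\<sigma>\<in>perms. (\<Omega> \<zeta> (perm_action \<sigma> v) + t * \<Omega> \<zeta> (perm_action \<sigma> u)) ^ Suc l)" for t
    using perm_E[OF _ E_add[OF v E_scale[OF u]]]
    by (simp add: sym_def lin_power_def perm_add perm_scale del: power_Suc plus_fun_apply)
  have "refl_bracket scale \<omega> n (power_sum \<eta> (Suc k)) (sym (lin_power \<zeta> (Suc l))) v =
      - (\<Sum>\<sigma>\<in>perms. of_nat (Suc l) * \<Omega> \<zeta> (perm_action \<sigma> v) ^ l * \<Omega> \<zeta> (perm_action \<sigma> u))"
  proof (rule refl_bracket_eqI)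
    show "hamiltonian_at (power_sum \<eta> (Suc k)) v u"
      unfolding u_def by (rule hamiltonian_power_sum[OF v])
    show "((\<lambda>t. sym (lin_power \<zeta> (Suc l)) (v + smul t u)) has_field_derivative
      (\<Sum>\<sigma>\<in>perms. of_nat (Suc l) * \<Omega> \<zeta> (perm_action \<sigma> v) ^ l * \<Omega> \<zeta> (perm_action \<sigma> u))) (at 0)"
      using * by (simp only: **)
  qed (use v sym_invariant[OF regular_lin_power] invariantD(1) in auto)
  also have "\<dots> = (\<Sum>\<sigma>\<in>perms. \<Sum>j\<in>I. of_nat (Suc k) * of_nat (Suc l) *
      (\<omega> \<eta> (\<zeta> j) * (\<omega> \<eta> (perm_action \<sigma> v j) ^ k * \<Omega> \<zeta> (perm_action \<sigma> v) ^ l)))"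
    unfolding sum_negf[symmetric]
    by (intro sum.cong refl) (simp add: \<Omega>u sum_distrib_left sum_distrib_right sum_negf mult_ac del: of_nat_Suc)
  also have "\<dots> = ?R"
    by (subst sum.swap) (simp add: sum_distrib_left)
  finally show ?thesis .
qed

lemma bracket_in_span: "f \<in> \<A> \<Longrightarrow> g \<in> \<A> \<Longrightarrow> refl_bracket scale \<omega> n f g \<in> \<B>"
  unfolding bracket_span_def
  by (rule module.span_base) (auto simp: module_iff_vector_space vector_space_fun_scale)

lemma subspace_bracket_span: "module.subspace (fun_scale (*)) \<B>"
  unfolding bracket_span_def
  by (rule module.subspace_span) (simp add: module_iff_vector_space vector_space_fun_scale)

text \<open>Since \<open>\<omega> \<eta> (v j)\<close> is the linear form
  \<open>\<Omega> (single j \<eta>)\<close>, the binomial theorem assembles its powers and those of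
  \<open>\<Omega> \<zeta>\<close> into powers of
  \<open>\<Omega> (\<zeta> + single j \<eta>)\<close>. The denominators in the weights cancel the
  factors \<open>Suc k\<close> and \<open>Suc (d - k)\<close> that differentiation produces.\<close>

lemma moment_relation:
  assumes \<zeta>: "\<omega> \<eta> (\<Sum>i\<in>I. \<zeta> i) = 0"
  shows "(\<Sum>j\<in>I. fun_scale (*) (\<omega> \<eta> (\<zeta> j)) (sym (lin_power (\<zeta> + single j \<eta>) d))) \<in> \<B>"
proof -
  interpret fm: vector_space "fun_scale (*) :: complex \<Rightarrow> ((nat \<Rightarrow> 'v) \<Rightarrow> complex) \<Rightarrow> _"
    by (rule vector_space_fun_scale)
  define G where "G k = refl_bracket scale \<omega> n (power_sum \<eta> (Suc k)) (sym (lin_power \<zeta> (Suc (d - k))))" for k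
  have "(\<Sum>j\<in>I. fun_scale (*) (\<omega> \<eta> (\<zeta> j)) (sym (lin_power (\<zeta> + single j \<eta>) d))) =
     (\<Sum>k\<le>d. fun_scale (*) (of_nat (d choose k) / (of_nat (Suc k) * of_nat (Suc (d - k)))) (G k))" (is "?L = ?R")
  proof
    fix v
    show "?L v = ?R v"
    proof (cases "v \<in> E")
      case True
      have "?R v = (\<Sum>k\<le>d. of_nat (d choose k) * (\<Sum>j\<in>I. \<omega> \<eta> (\<zeta> j) *
          (\<Sum>\<sigma>\<in>perms. \<omega> \<eta> (perm_action \<sigma> v j) ^ k * \<Omega> \<zeta> (perm_action \<sigma> v) ^ (d - k))))"
        by (simp add: sum_fun_at fun_scale_def G_def bracket_power_sum[OF True \<zeta>] del: of_nat_Suc)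
      also have "\<dots> = (\<Sum>j\<in>I. \<Sum>k\<le>d. \<Sum>\<sigma>\<in>perms. \<omega> \<eta> (\<zeta> j) * (of_nat (d choose k) *
          \<omega> \<eta> (perm_action \<sigma> v j) ^ k * \<Omega> \<zeta> (perm_action \<sigma> v) ^ (d - k)))"
        unfolding sum_distrib_left by (subst sum.swap) (simp only: mult_ac)
      also have "\<dots> = (\<Sum>j\<in>I. \<omega> \<eta> (\<zeta> j) * (\<Sum>\<sigma>\<in>perms. \<Sum>k\<le>d. of_nat (d choose k) *
          \<omega> \<eta> (perm_action \<sigma> v j) ^ k * \<Omega> \<zeta> (perm_action \<sigma> v) ^ (d - k)))"
        unfolding sum_distrib_left by (intro sum.cong[OF refl] sum.swap)
      also have "\<dots> = (\<Sum>j\<in>I. \<omega> \<eta> (\<zeta> j) * (\<Sum>\<sigma>\<in>perms. \<Omega> (\<zeta> + single j \<eta>) (perm_action \<sigma> v) ^ d))"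
        by (intro sum.cong refl arg_cong2[of _ _ _ _ "(*)"])
           (simp add: binomial_ring[symmetric] add.commute)
      also have "\<dots> = ?L v"
        using perm_E[OF _ True]
        by (simp add: sum_fun_at fun_scale_def sym_def lin_power_def del: plus_fun_apply)
      finally show ?thesis ..
    next
      case False
      then show ?thesis
        using perm_E_iff
        by (simp add: sum_fun_at fun_scale_def sym_def lin_power_def G_def refl_bracket_def poisson_bracket_def)
    qed
  qed
  also have "\<dots> \<in> \<B>"
    unfolding G_def
    by (intro fm.subspace_sum fm.subspace_scale subspace_bracket_span bracket_in_span power_sum_invariant
        sym_invariant regular_lin_power)
  finally show ?thesis .
qed

text \<open>The expansion in \<open>t\<close> serves twice: for perturbation to generic tuples and
  for polarization.\<close>

lemma lin_power_add:
  "lin_power (\<xi> + smul t \<zeta>) d =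
    (\<Sum>k\<le>d. fun_scale (*) (t ^ k) (fun_scale (*) (of_nat (d choose k)) (lin_power \<zeta> k * lin_power \<xi> (d - k))))"
  by (auto simp: fun_eq_iff sum_fun_at lin_power_def fun_scale_def[of "(*)"] binomial_ring power_mult_distrib
      add.commute[of "\<Omega> \<xi> _"] mult_ac simp del: plus_fun_apply)

end

subsection \<open>Poisson traces\<close>

text \<open>A functional on functions instead of cosets, later instantiated with
  \<open>\<lambda>f. \<epsilon> (coset f)\<close>. Nothing is assumed off \<open>\<A>\<close>, hence
  the membership conditions below.\<close>

locale poisson_trace = symplectic_space scale Basis \<omega> n
  for scale :: "complex \<Rightarrow> 'v::ab_group_add \<Rightarrow> 'v" and Basis \<omega> n +
  fixes \<Phi> :: "((nat \<Rightarrow> 'v) \<Rightarrow> complex) \<Rightarrow> complex"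
  assumes trace_add: "f \<in> \<A> \<Longrightarrow> g \<in> \<A> \<Longrightarrow> \<Phi> (f + g) = \<Phi> f + \<Phi> g"
    and trace_scale: "f \<in> \<A> \<Longrightarrow> \<Phi> (fun_scale (*) c f) = c * \<Phi> f"
    and trace_bracket: "f \<in> \<A> \<Longrightarrow> f \<in> \<B> \<Longrightarrow> \<Phi> f = 0"
begin

lemma trace_zero: "\<Phi> 0 = 0"
  using trace_add[OF invariant_zero invariant_zero] by simp

lemma trace_sum:
  assumes "\<And>i. i \<in> F \<Longrightarrow> f i \<in> \<A>"
  shows "(\<Sum>i\<in>F. f i) \<in> \<A>" "\<Phi> (\<Sum>i\<in>F. f i) = (\<Sum>i\<in>F. \<Phi> (f i))"
proof -
  have "(\<Sum>i\<in>F. f i) \<in> \<A> \<and> \<Phi> (\<Sum>i\<in>F. f i) = (\<Sum>i\<in>F. \<Phi> (f i))"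
    using assms
  proof (induction F rule: infinite_finite_induct)
    case (insert x F)
    then have "f x \<in> \<A>" "(\<Sum>i\<in>F. f i) \<in> \<A>" "\<Phi> (\<Sum>i\<in>F. f i) = (\<Sum>i\<in>F. \<Phi> (f i))"
      by auto
    then show ?case
      by (simp only: sum.insert[OF insert.hyps(1,2)] trace_add invariant_add simp_thms)
  qed (simp_all only: sum.infinite sum.empty invariant_zero trace_zero simp_thms)
  then show "(\<Sum>i\<in>F. f i) \<in> \<A>" "\<Phi> (\<Sum>i\<in>F. f i) = (\<Sum>i\<in>F. \<Phi> (f i))" by auto
qed

section \<open>Moments of symmetrized powers of linear forms\<close>

definition moment :: "nat \<Rightarrow> (nat \<Rightarrow> 'v) \<Rightarrow> complex" where
  "moment d \<xi> = \<Phi> (sym (lin_power \<xi> d))"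

text \<open>\<open>moment d\<close> is the function \<open>\<phi>\<close> of the introduction;
  applying the trace to \<open>moment_relation\<close> gives its relation.\<close>

lemma moment_eq:
  assumes "\<omega> \<eta> (\<Sum>i\<in>I. \<zeta> i) = 0"
  shows "(\<Sum>j\<in>I. \<omega> \<eta> (\<zeta> j) * moment d (\<zeta> + single j \<eta>)) = 0"
proof -
  let ?f = "\<lambda>j. fun_scale (*) (\<omega> \<eta> (\<zeta> j)) (sym (lin_power (\<zeta> + single j \<eta>) d))"
  have inv: "sym (lin_power (\<zeta> + single j \<eta>) d) \<in> \<A>" for j
    by (intro sym_invariant regular_lin_power)
  then have "?f j \<in> \<A>" for j
    by (rule invariant_scale)
  then have "\<Phi> (\<Sum>j\<in>I. ?f j) = (\<Sum>j\<in>I. \<Phi> (?f j))" "\<Phi> (\<Sum>j\<in>I. ?f j) = 0"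
    using trace_bracket[OF _ moment_relation[OF assms]] trace_sum[of I ?f] by blast+
  then show ?thesis
    by (simp only: moment_def trace_scale[OF inv])
qed

text \<open>Permuting \<open>\<xi>\<close> amounts to composing the linear form with the inverse
  permutation, which \<open>sym\<close> absorbs.\<close>

lemma moment_perm:
  assumes \<tau>: "\<tau> permutes I"
  shows "moment d (perm_action \<tau> \<xi>) = moment d \<xi>"
proof -
  have "\<Omega> (perm_action \<tau> \<xi>) v = \<Omega> \<xi> (perm_action (inv \<tau>) v)" for v
    using tuple_form_perm[OF permutes_inv[OF \<tau>], of "perm_action \<tau> \<xi>" v] perm_inv_cancel[OF \<tau>, of \<xi>] by metis
  then have "lin_power (perm_action \<tau> \<xi>) d = (\<lambda>v. lin_power \<xi> d (perm_action (inv \<tau>) v))"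
    using perm_E_iff[OF permutes_inv[OF \<tau>]] by (auto simp: lin_power_def fun_eq_iff)
  then show ?thesis
    by (simp add: moment_def sym_perm[OF permutes_inv[OF \<tau>]])
qed

lemma moment_line:
  obtains c :: "nat \<Rightarrow> complex" where "\<And>t. moment d (\<xi> + smul t \<zeta>) = (\<Sum>k\<le>d. c k * t ^ k)"
proof
  fix t
  have inv: "sym (fun_scale (*) (of_nat (d choose k)) (lin_power \<zeta> k * lin_power \<xi> (d - k))) \<in> \<A>" for k
    by (intro sym_invariant regular_scale regular_functions.mult regular_lin_power)
  show "moment d (\<xi> + smul t \<zeta>) =
      (\<Sum>k\<le>d. \<Phi> (sym (fun_scale (*) (of_nat (d choose k)) (lin_power \<zeta> k * lin_power \<xi> (d - k)))) * t ^ k)"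
    unfolding moment_def lin_power_add sym_sum sym_scale[of "t ^ _"]
    using trace_sum(2)[of "{..d}", OF invariant_scale[OF inv]]
    by (simp only: trace_scale[OF inv] mult.commute)
qed

text \<open>As \<open>\<zeta>\<close> sums to \<open>- \<eta>\<close>, the relation
  \<open>moment_eq\<close> applies, and \<open>c\<close> may be subtracted from every moment in it.
  Slots outside \<open>p\<close> to \<open>n\<close> then contribute nothing, and each slot from
  \<open>p\<close> to \<open>n\<close> contributes the same multiple of
  \<open>moment d \<xi> - c\<close>. Slot n + 1 is left free to balance the sum.\<close>

lemma moment_replace_component:
  assumes "\<xi> \<in> E" "1 \<le> p" "p \<le> n" "\<And>j. p < j \<Longrightarrow> j \<le> n \<Longrightarrow> \<xi> j = a" "\<omega> (\<xi> p) a \<noteq> 0"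
    and IH: "\<And>\<zeta>. \<zeta> \<in> E \<Longrightarrow> (\<And>j. p \<le> j \<Longrightarrow> j \<le> n \<Longrightarrow> \<zeta> j = a) \<Longrightarrow> moment d \<zeta> = c"
  shows "moment d \<xi> = c"
proof -
  define \<eta> where "\<eta> = \<xi> p - a"
  define \<zeta> where "\<zeta> = (\<lambda>j. if j = p then a else \<xi> j)"
  have p: "p \<in> I" using assms by simp
  have sum_single: "(\<Sum>i\<in>I. single j x i) = x" if "j \<in> I" for j and x :: 'v
    using that by (simp add: single_def sum.delta)
  have "\<zeta> = \<xi> + single p (- \<eta>)"
    by (auto simp: \<zeta>_def \<eta>_def single_def fun_eq_iff)
  then have sum_\<zeta>: "(\<Sum>i\<in>I. \<zeta> i) = - \<eta>"
    using assms(1) sum_single[OF p] by (simp add: sum.distrib refl_tensor_def)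
  have \<zeta>E: "\<zeta> + single j \<eta> \<in> E" if "j \<in> I" for j
    using that assms(1) p sum_single[OF that] sum_\<zeta>
    by (auto simp: refl_tensor_def sum.distrib \<zeta>_def) (auto simp: single_def)
  \<comment> \<open>Here \<open>j\<close> lies before \<open>p\<close> or equals n + 1, so slots
    \<open>p\<close> to \<open>n\<close> still carry \<open>a\<close>.\<close>
  have far: "moment d (\<zeta> + single j \<eta>) = c" if "j \<in> I" "j \<notin> {p..n}" for j
    using that assms(4) by (intro IH \<zeta>E) (auto simp: \<zeta>_def single_def)
  \<comment> \<open>Adding \<open>\<eta>\<close> to a slot that carries \<open>a\<close> puts
    \<open>\<xi> p\<close> there, so the tuple is \<open>\<xi>\<close> with slots \<open>p\<close>
    and \<open>j\<close> exchanged.\<close>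
  have near: "moment d (\<zeta> + single j \<eta>) = moment d \<xi>" if "j \<in> {p..n}" for j
  proof -
    have \<tau>: "Transposition.transpose p j permutes I"
      using that p by (intro permutes_swap_id) auto
    have "\<zeta> + single j \<eta> = perm_action (Transposition.transpose p j) \<xi>"
      using that assms(4) by (auto simp: fun_eq_iff \<zeta>_def \<eta>_def single_def perm_action_def Transposition.transpose_def)
    then show ?thesis using moment_perm[OF \<tau>] by simp
  qed
  have \<eta>a: "\<omega> \<eta> a = \<omega> (\<xi> p) a" by (simp add: \<eta>_def)
  have "0 = (\<Sum>j\<in>I. \<omega> \<eta> (\<zeta> j) * moment d (\<zeta> + single j \<eta>))"
    by (rule moment_eq[symmetric]) (simp only: sum_\<zeta> omega_minus omega_zero minus_zero)
  also have "\<dots> = (\<Sum>j\<in>I. \<omega> \<eta> (\<zeta> j) * c + (if j \<in> {p..n} then \<omega> \<eta> a * (moment d \<xi> - c) else 0))"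
  proof (rule sum.cong[OF refl])
    fix j assume j: "j \<in> I"
    show "\<omega> \<eta> (\<zeta> j) * moment d (\<zeta> + single j \<eta>) =
        \<omega> \<eta> (\<zeta> j) * c + (if j \<in> {p..n} then \<omega> \<eta> a * (moment d \<xi> - c) else 0)"
    proof (cases "j \<in> {p..n}")
      case True
      then have "\<zeta> j = a" using assms(4) by (auto simp: \<zeta>_def)
      then show ?thesis using near[OF True] True by (simp add: algebra_simps del: plus_fun_apply)
    next
      case False
      then show ?thesis using far[OF j False] by (simp only: if_False add_0_right)
    qed
  qed
  \<comment> \<open>The first summand is a multiple of \<open>\<omega> \<eta> (- \<eta>)\<close>,
    hence zero.\<close>
  also have "\<dots> = \<omega> \<eta> (\<Sum>j\<in>I. \<zeta> j) * c + (\<Sum>j\<in>I \<inter> {p..n}. \<omega> \<eta> a * (moment d \<xi> - c))"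
    by (simp only: sum.distrib sum_distrib_right omega_sum(1) sum.inter_restrict[OF finite_atLeastAtMost])
  also have "\<dots> = of_nat (card (I \<inter> {p..n})) * (\<omega> \<eta> a * (moment d \<xi> - c))"
    by (simp only: sum_\<zeta> omega_minus omega_zero sum_constant minus_zero mult_zero_left add_0_left)
  finally have "of_nat (card (I \<inter> {p..n})) * (\<omega> \<eta> a * (moment d \<xi> - c)) = 0" ..
  moreover have "p \<in> I \<inter> {p..n}" using p assms(3) by simp
  then have "card (I \<inter> {p..n}) \<noteq> 0"
    by (metis card_0_eq empty_iff finite_Int finite_atLeastAtMost)
  ultimately show ?thesis
    using assms(5) unfolding mult_eq_0_iff of_nat_eq_0_iff \<eta>a by simp
qed

text \<open>Induction on the length \<open>k\<close> of the initial segment whose slots are free;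
  the following slots up to \<open>n\<close> carry \<open>a\<close>, and slot n + 1 is forced by the
  zero sum. Tuples with \<open>\<omega> (\<xi> (Suc k)) a = 0\<close> escape
  \<open>moment_replace_component\<close> and are reached as limits, with \<open>z\<close> as the
  perturbing direction.\<close>

lemma moment_constant:
  assumes z: "\<omega> z a \<noteq> 0"
  obtains c where "\<And>\<xi>. \<xi> \<in> E \<Longrightarrow> moment d \<xi> = c"
proof -
  define \<xi>\<^sub>0 where "\<xi>\<^sub>0 = (\<lambda>j. if j \<in> {1..n} then a else if j = n+1 then - (\<Sum>j\<in>{1..n}. a) else 0)"
  have "moment d \<xi> = moment d \<xi>\<^sub>0" if "\<xi> \<in> E" "\<And>j. k < j \<Longrightarrow> j \<le> n \<Longrightarrow> \<xi> j = a" "k \<le> n" for k \<xi>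
    using that
  proof (induction k arbitrary: \<xi>)
    case 0
    have "I = insert (n+1) {1..n}" by auto
    then have "\<xi> (n+1) + (\<Sum>j\<in>{1..n}. \<xi> j) = 0"
      using 0(1) by (simp add: refl_tensor_def)
    moreover have "(\<Sum>j\<in>{1..n}. \<xi> j) = (\<Sum>j\<in>{1..n}. a)"
      using 0(2) by (intro sum.cong) auto
    ultimately have "\<xi> (n+1) = - (\<Sum>j\<in>{1..n}. a)"
      by (simp add: eq_neg_iff_add_eq_0)
    then have "\<xi> = \<xi>\<^sub>0"
      using 0(1,2) by (auto simp: \<xi>\<^sub>0_def fun_eq_iff refl_tensor_def)
    then show ?case by simp
  next
    case (Suc k)
    have generic: "moment d \<zeta> = moment d \<xi>\<^sub>0"
      if "\<zeta> \<in> E" "\<And>j. Suc k < j \<Longrightarrow> j \<le> n \<Longrightarrow> \<zeta> j = a" "\<omega> (\<zeta> (Suc k)) a \<noteq> 0" for \<zeta>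
      using that Suc.prems(3) by (intro moment_replace_component[of \<zeta> "Suc k" a]) (auto intro: Suc.IH)
    show ?case
    proof (cases "\<omega> (\<xi> (Suc k)) a = 0")
      case True
      \<comment> \<open>Perturb \<open>\<xi>\<close> along \<open>\<zeta>\<close> to reach the generic case; \<open>moment\<close> is polynomial on the line.\<close>
      define \<zeta> where "\<zeta> = single (Suc k) z + single (n+1) (- z)"
      have "\<zeta> \<in> E"
        using Suc.prems(3) by (auto simp: \<zeta>_def refl_tensor_def sum.distrib single_def sum.delta)
      obtain c where c: "\<And>t. moment d (\<xi> + smul t \<zeta>) = (\<Sum>k\<le>d. c k * t ^ k)"
        using moment_line by blast
      \<comment> \<open>On the line, slot \<open>Suc k\<close> pairs with \<open>a\<close> to
        \<open>t * \<omega> z a\<close>, and the slots after it up to \<open>n\<close> are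
        untouched.\<close>
      have at: "moment d (\<xi> + smul t \<zeta>) = moment d \<xi>\<^sub>0" if "t \<noteq> 0" for t
        using that Suc.prems True z
        by (intro generic E_add E_scale \<open>\<zeta> \<in> E\<close>) (auto simp: \<zeta>_def single_def fun_scale_def)
      have "((\<lambda>t. \<Sum>k\<le>d. c k * t ^ k) \<longlongrightarrow> (\<Sum>k\<le>d. c k * 0 ^ k)) (at 0)"
        by (intro tendsto_intros)
      moreover have "((\<lambda>t. \<Sum>k\<le>d. c k * t ^ k) \<longlongrightarrow> moment d \<xi>\<^sub>0) (at 0)"
        by (rule tendsto_eventually) (auto simp: eventually_at_filter at[unfolded c])
      ultimately have "(\<Sum>k\<le>d. c k * 0 ^ k) = moment d \<xi>\<^sub>0"
        using LIM_unique by blast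
      then show ?thesis using c[of 0] by simp
    qed (use generic Suc.prems in blast)
  qed
  \<comment> \<open>For \<open>k = n\<close> no slot is constrained.\<close>
  from this[of _ n] show thesis using that by auto
qed

text \<open>The constant value is read off at the zero tuple, where a positive power of the linear
  form vanishes.\<close>

lemma moment_eq_zero:
  assumes "\<xi> \<in> E"
  shows "moment (Suc d) \<xi> = 0"
proof -
  have "lin_power 0 (Suc d) = 0"
    by (auto simp: lin_power_def fun_eq_iff)
  then have "moment (Suc d) 0 = 0"
    by (simp add: moment_def sym_def trace_zero[unfolded zero_fun_def])
  moreover have "moment (Suc d) \<xi> = moment (Suc d) 0"
  proof (cases "\<exists>z a. \<omega> z a \<noteq> 0")
    case True
    then show ?thesis using moment_constant assms E_zero by metis
  next
    \<comment> \<open>By nondegeneracy the whole space is zero, so there is no \<open>a\<close> to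
      start from.\<close>
    case False
    then have "\<xi> = 0" using omega_nondegenerate by (auto simp: fun_eq_iff)
    then show ?thesis by simp
  qed
  ultimately show ?thesis by simp
qed

section \<open>From powers of linear forms to all regular functions\<close>

text \<open>Compares \<open>\<Phi>\<close> after \<open>sym\<close> with the multiple of evaluation
  at 0 that it should equal. It is taken on all regular functions because these, unlike the
  invariant ones, come with an induction rule.\<close>

definition defect :: "((nat \<Rightarrow> 'v) \<Rightarrow> complex) \<Rightarrow> complex" where
  "defect f = \<Phi> (sym f) - of_nat (fact (n+1)) * \<Phi> (const 1) * f 0"

lemma defect_add: "f \<in> regular \<Longrightarrow> g \<in> regular \<Longrightarrow> defect (f + g) = defect f + defect g"
  by (simp add: defect_def sym_add trace_add sym_invariant algebra_simps del: fact_Suc)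

lemma defect_scale: "f \<in> regular \<Longrightarrow> defect (fun_scale (*) c f) = c * defect f"
  unfolding defect_def sym_scale
  by (simp only: trace_scale[OF sym_invariant]) (simp add: fun_scale_def algebra_simps del: fact_Suc)

lemma defect_sum: "(\<And>i. i \<in> F \<Longrightarrow> f i \<in> regular) \<Longrightarrow> defect (\<Sum>i\<in>F. f i) = (\<Sum>i\<in>F. defect (f i))"
  by (simp add: defect_def sym_sum trace_sum sym_invariant sum_subtractf sum_distrib_left sum_fun_at del: fact_Suc)

text \<open>Degree zero fixes the constant in \<open>defect\<close>; in positive degree both of its
  terms vanish.\<close>

lemma defect_lin_power: "\<xi> \<in> E \<Longrightarrow> defect (lin_power \<xi> d) = 0"
proof (cases d)
  case 0
  then show ?thesis
    by (simp add: defect_def lin_power_0 sym_invariant_eq invariant_const trace_scale del: fact_Suc)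
       (simp add: const_def)
next
  case (Suc m)
  then show "\<xi> \<in> E \<Longrightarrow> ?thesis"
    using moment_eq_zero[of \<xi> m] by (simp add: defect_def moment_def) (simp add: lin_power_def)
qed

text \<open>
  For a linear form \<open>f\<close> this is polarization: compare the coefficients of \<open>t\<close> in the
  vanishing defect of \<open>h\<close> times a power of \<open>\<Omega> (\<xi> + smul t \<mu>)\<close>.
\<close>

lemma defect_mult_lin_power:
  assumes "f \<in> regular" "h \<in> regular" "\<And>\<xi> d. \<xi> \<in> E \<Longrightarrow> defect (h * lin_power \<xi> d) = 0" "\<xi> \<in> E"
  shows "defect (f * h * lin_power \<xi> d) = 0"
  using assms
proof (induction arbitrary: h \<xi> d rule: regular_functions.induct)
  case (const c)
  have "(\<lambda>x. if x \<in> E then c else 0) * h * lin_power \<xi> d = fun_scale (*) c (h * lin_power \<xi> d)"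
    by (auto simp: fun_eq_iff fun_scale_def lin_power_def)
  then show ?case
    using const by (simp only: defect_scale[OF regular_functions.mult[OF _ regular_lin_power]] mult_zero_right)
next
  case (linear \<alpha>)
  obtain \<mu> where \<mu>: "\<mu> \<in> E" "\<And>v. v \<in> E \<Longrightarrow> \<alpha> v = \<Omega> \<mu> v"
    using tuple_form_riesz[OF linear(1)] by blast
  then have \<alpha>: "\<alpha> = lin_power \<mu> 1"
    using linear(1) by (auto simp: lin_power_def dual_space_def fun_eq_iff)
  \<comment> \<open>The functions multiplying \<open>t ^ k\<close>. With exponent
    \<open>Suc d\<close>, the one for \<open>k = 1\<close> is d + 1 times the product
    wanted.\<close>
  let ?g = "\<lambda>k. fun_scale (*) (of_nat (Suc d choose k)) (h * (lin_power \<mu> k * lin_power \<xi> (Suc d - k)))"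
  have reg: "?g k \<in> regular" for k
    using linear(2) by (intro regular_scale regular_functions.mult regular_lin_power)
  have "(\<Sum>k\<le>Suc d. defect (?g k) * t ^ k) = 0" for t
  proof -
    have "h * lin_power (\<xi> + smul t \<mu>) (Suc d) = (\<Sum>k\<le>Suc d. fun_scale (*) (t ^ k) (?g k))"
      unfolding lin_power_add sum_distrib_left by (intro sum.cong refl) (auto simp: fun_eq_iff fun_scale_def)
    moreover have "defect (h * lin_power (\<xi> + smul t \<mu>) (Suc d)) = 0"
      using linear \<mu> by (intro linear(3) E_add E_scale)
    ultimately have "defect (\<Sum>k\<le>Suc d. fun_scale (*) (t ^ k) (?g k)) = 0"
      by simp
    then show ?thesis
      by (simp only: defect_sum[OF regular_scale[OF reg]] defect_scale[OF reg] mult.commute)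
  qed
  then have "defect (?g 1) = 0"
    using polyfun_eq_0[where c = "\<lambda>k. defect (?g k)" and n = "Suc d"] by auto
  then have "of_nat (Suc d choose 1) * defect (h * (lin_power \<mu> 1 * lin_power \<xi> (Suc d - 1))) = 0"
    using linear(2) by (subst (asm) defect_scale) (intro regular_functions.mult regular_lin_power)
  then have "defect (h * (lin_power \<mu> 1 * lin_power \<xi> d)) = 0"
    by (simp del: of_nat_Suc)
  moreover have "\<alpha> * h * lin_power \<xi> d = h * (lin_power \<mu> 1 * lin_power \<xi> d)"
    by (simp only: \<alpha> mult_ac)
  ultimately show ?case by (simp only:)
next
  case (add f g)
  have "(f + g) * h * lin_power \<xi> d = f * h * lin_power \<xi> d + g * h * lin_power \<xi> d"
    by (simp only: distrib_right)
  moreover have "defect (f * h * lin_power \<xi> d + g * h * lin_power \<xi> d) =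
      defect (f * h * lin_power \<xi> d) + defect (g * h * lin_power \<xi> d)"
    using add by (intro defect_add regular_functions.mult regular_lin_power)
  moreover have "defect (f * h * lin_power \<xi> d) = 0" "defect (g * h * lin_power \<xi> d) = 0"
    using add.prems by (auto intro: add.IH simp del: times_fun_apply)
  ultimately show ?case by (simp only: add_0_right)
next
  \<comment> \<open>The arbitrary factor \<open>h\<close> absorbs one factor at a time: the
    hypothesis for \<open>g\<close> makes \<open>g * h\<close> admissible in the hypothesis for
    \<open>f\<close>.\<close>
  case (mult f g)
  have "f * g * h * lin_power \<xi> d = f * (g * h) * lin_power \<xi> d"
    by (simp only: mult.assoc)
  then show ?case
    using mult.IH(1)[of "g * h"] mult.IH(2) mult.prems mult.hyps regular_functions.mult by metis
qed

text \<open>Taking \<open>const 1\<close> for \<open>h\<close> and a zeroth power leaves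
  \<open>f\<close> itself; the factor (n+1)! from \<open>sym\<close> on invariants is then
  cancelled.\<close>

lemma trace_eq:
  assumes "f \<in> \<A>"
  shows "\<Phi> f = \<Phi> (const 1) * f 0"
proof -
  have reg: "f \<in> regular" "const 1 \<in> regular"
    using assms invariant_const invariantD(1) by blast+
  \<comment> \<open>\<open>const 1\<close> is the indicator of \<open>E\<close>, a unit for
    functions that vanish outside \<open>E\<close>.\<close>
  have "const 1 * lin_power \<xi> d = lin_power \<xi> d" "f * const 1 * lin_power 0 0 = f" for \<xi> d
    using regular_outside[OF reg(1)] by (auto simp: fun_eq_iff const_def lin_power_def)
  then have "defect f = 0"
    using defect_mult_lin_power[OF reg, of 0 0] defect_lin_power E_zero by simp
  then have "of_nat (fact (n+1)) * (\<Phi> f - \<Phi> (const 1) * f 0) = 0"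
    by (simp add: defect_def sym_invariant_eq assms trace_scale algebra_simps del: fact_Suc)
  then show ?thesis by (simp del: fact_Suc)
qed

end

subsection \<open>The dual of the zeroth Poisson homology\<close>

context symplectic_space
begin

abbreviation coset :: "((nat \<Rightarrow> 'v) \<Rightarrow> complex) \<Rightarrow> ((nat \<Rightarrow> 'v) \<Rightarrow> complex) set" where
  "coset \<equiv> HP0_class scale \<omega> n"

abbreviation HP :: "((nat \<Rightarrow> 'v) \<Rightarrow> complex) set set" where
  "HP \<equiv> HP0 (fun_scale (*)) \<A> (refl_bracket scale \<omega> n)"

abbreviation HP_scale :: "complex \<Rightarrow> ((nat \<Rightarrow> 'v) \<Rightarrow> complex) set \<Rightarrow> ((nat \<Rightarrow> 'v) \<Rightarrow> complex) set" where
  "HP_scale \<equiv> HP0_scale (fun_scale (*)) \<A> (refl_bracket scale \<omega> n)"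

interpretation fm: vector_space "fun_scale (*) :: complex \<Rightarrow> ((nat \<Rightarrow> 'v) \<Rightarrow> complex) \<Rightarrow> _"
  by (rule vector_space_fun_scale)

text \<open>Classes are added as sets, so the two copies of \<open>\<B>\<close> have to merge into
  one.\<close>

lemma coset_add: "coset f + coset g = coset (f + g)"
proof -
  have "\<B> + \<B> = \<B>"
  proof
    show "\<B> + \<B> \<subseteq> \<B>"
      using fm.subspace_add[OF subspace_bracket_span] by (auto simp only: set_plus_def)
    show "\<B> \<subseteq> \<B> + \<B>"
      using set_zero_plus2[OF fm.subspace_0[OF subspace_bracket_span]] .
  qed
  then show ?thesis by (simp only: set_plus_rearrange)
qed

lemma coset_scale: "HP_scale c (coset f) = coset (fun_scale (*) c f)"
proof
  show "HP_scale c (coset f) \<subseteq> coset (fun_scale (*) c f)"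
  proof
    fix x assume "x \<in> HP_scale c (coset f)"
    then obtain b b' where b: "b \<in> \<B>" "b' \<in> \<B>" and x: "x = fun_scale (*) c (f + b) + b'"
      by (auto simp only: HP0_scale_def elt_set_plus_def set_plus_def)
    have "x = fun_scale (*) c f + (fun_scale (*) c b + b')"
      by (simp only: x fm.scale_right_distrib add.assoc)
    moreover have "fun_scale (*) c b + b' \<in> \<B>"
      by (intro fm.subspace_add fm.subspace_scale subspace_bracket_span b)
    ultimately show "x \<in> coset (fun_scale (*) c f)"
      by (auto simp only: elt_set_plus_def)
  qed
  show "coset (fun_scale (*) c f) \<subseteq> HP_scale c (coset f)"
  proof
    fix x assume "x \<in> coset (fun_scale (*) c f)"
    then obtain b where b: "b \<in> \<B>" and x: "x = fun_scale (*) c (f + 0) + b"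
      by (auto simp only: elt_set_plus_def add_0_right)
    have "f + 0 \<in> coset f"
      using fm.subspace_0[OF subspace_bracket_span] by (blast intro: set_plus_intro2)
    then show "x \<in> HP_scale c (coset f)"
      unfolding x HP0_scale_def using b by (intro set_plus_intro imageI)
  qed
qed

lemma coset_bracket:
  assumes "f \<in> \<B>"
  shows "coset f = coset 0"
proof
  show "coset f \<subseteq> coset 0"
  proof
    fix x assume "x \<in> coset f"
    then obtain b where "b \<in> \<B>" "x = f + b" by (auto simp only: elt_set_plus_def)
    then have "x \<in> \<B>" using fm.subspace_add[OF subspace_bracket_span assms] by blast
    then show "x \<in> coset 0" by (auto simp only: elt_set_plus_def add_0_left)
  qed
  show "coset 0 \<subseteq> coset f"
  proof
    fix x assume "x \<in> coset 0"
    then have "x \<in> \<B>" by (auto simp only: elt_set_plus_def add_0_left)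
    then have "x - f \<in> \<B>" using fm.subspace_diff[OF subspace_bracket_span _ assms] by blast
    moreover have "x = f + (x - f)" by (simp only: add_diff_eq add_diff_cancel_left')
    ultimately show "x \<in> coset f" by (auto simp only: elt_set_plus_def)
  qed
qed

lemma HP_iff: "X \<in> HP \<longleftrightarrow> (\<exists>f\<in>\<A>. X = coset f)"
  by (auto simp only: HP0_def)

lemma coset_in_HP: "f \<in> \<A> \<Longrightarrow> coset f \<in> HP"
  unfolding HP0_def by (rule imageI)

text \<open>Makes evaluation at the origin independent of the representative of a coset.\<close>

lemma bracket_span_at_origin: "b \<in> \<B> \<Longrightarrow> b 0 = 0"
proof -
  have "fm.subspace {b. b 0 = 0}"
    by (auto simp: fm.subspace_def fun_scale_def)
  then have "\<B> \<subseteq> {b. b 0 = 0}"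
    unfolding bracket_span_def by (intro fm.span_minimal) (auto simp: bracket_zero_at_origin)
  then show "b \<in> \<B> \<Longrightarrow> b 0 = 0" by blast
qed

text \<open>\<open>THE\<close> is justified because all representatives of a coset agree at 0; the
  value 0 elsewhere is what \<open>dual_space\<close> demands.\<close>

definition augmentation :: "((nat \<Rightarrow> 'v) \<Rightarrow> complex) set \<Rightarrow> complex" where
  "augmentation X = (if X \<in> HP then THE y. \<exists>g\<in>X. y = g 0 else 0)"

lemma augmentation_coset:
  assumes "f \<in> \<A>"
  shows "augmentation (coset f) = f 0"
proof -
  have at_0: "g 0 = f 0" if "g \<in> coset f" for g
    using that bracket_span_at_origin by (auto simp: elt_set_plus_def)
  have mem: "f + 0 \<in> coset f"
    using fm.subspace_0[OF subspace_bracket_span] by (rule set_plus_intro2)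
  have "(THE y. \<exists>g\<in>coset f. y = g 0) = f 0"
  proof (rule the_equality)
    show "\<exists>g\<in>coset f. f 0 = g 0" using mem at_0[OF mem] by metis
  qed (use at_0 in blast)
  moreover have "coset f \<in> HP" using assms by (rule coset_in_HP)
  ultimately show ?thesis by (simp only: augmentation_def if_True)
qed

lemma augmentation_dual: "augmentation \<in> HP0_quotient_dual scale \<omega> n"
  unfolding HP0_dual_def dual_space_def
proof (intro CollectI conjI ballI allI impI)
  fix X Y assume "X \<in> HP" "Y \<in> HP"
  then obtain f g where "f \<in> \<A>" "X = coset f" "g \<in> \<A>" "Y = coset g" by (auto simp only: HP_iff)
  then show "augmentation (X + Y) = augmentation X + augmentation Y"
    by (simp only: coset_add augmentation_coset invariant_add plus_fun_apply)
next
  fix c X assume "X \<in> HP"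
  then obtain f where "f \<in> \<A>" "X = coset f" by (auto simp only: HP_iff)
  then show "augmentation (HP_scale c X) = c * augmentation X"
    by (simp only: coset_scale augmentation_coset invariant_scale) (simp only: fun_scale_def)
qed (simp add: augmentation_def)

text \<open>Composed with \<open>coset\<close>, the functional becomes a Poisson trace, so
  \<open>trace_eq\<close> determines it from its value on the class of the constant 1.\<close>

lemma dual_eq_multiple:
  assumes "\<epsilon> \<in> HP0_quotient_dual scale \<omega> n"
  shows "\<epsilon> = fun_scale (*) (\<epsilon> (coset (const 1))) augmentation"
proof
  fix X
  have add: "\<epsilon> (X + Y) = \<epsilon> X + \<epsilon> Y" if "X \<in> HP" "Y \<in> HP" for X Y
    using assms that by (auto simp: HP0_dual_def dual_space_def)
  have scale: "\<epsilon> (HP_scale c X) = c * \<epsilon> X" if "X \<in> HP" for c X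
    using assms that by (auto simp: HP0_dual_def dual_space_def)
  have outside: "\<epsilon> X = 0" if "X \<notin> HP" for X
    using assms that by (auto simp: HP0_dual_def dual_space_def)
  have zero: "\<epsilon> (coset 0) = 0"
    using add[OF coset_in_HP coset_in_HP, OF invariant_zero invariant_zero] by (simp only: coset_add add_0_right) simp
  interpret poisson_trace scale Basis \<omega> n "\<lambda>f. \<epsilon> (coset f)"
  proof
    show "\<epsilon> (coset (f + g)) = \<epsilon> (coset f) + \<epsilon> (coset g)" if "f \<in> \<A>" "g \<in> \<A>" for f g
      using add[OF coset_in_HP coset_in_HP] that by (simp only: coset_add)
    show "\<epsilon> (coset (fun_scale (*) c f)) = c * \<epsilon> (coset f)" if "f \<in> \<A>" for c f
      using scale[OF coset_in_HP] that by (simp only: coset_scale)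
    show "\<epsilon> (coset f) = 0" if "f \<in> \<A>" "f \<in> \<B>" for f
      using coset_bracket[OF that(2)] zero by simp
  qed
  show "\<epsilon> X = fun_scale (*) (\<epsilon> (coset (const 1))) augmentation X"
  proof (cases "X \<in> HP")
    case True
    then obtain f where f: "f \<in> \<A>" "X = coset f" by (auto simp only: HP_iff)
    then show ?thesis
      using trace_eq[OF f(1)] by (simp only: fun_scale_def augmentation_coset)
  next
    case False
    then show ?thesis using outside by (simp add: fun_scale_def augmentation_def)
  qed
qed

lemma dual_eq_range:
  "HP0_quotient_dual scale \<omega> n = range (\<lambda>c. fun_scale (*) c augmentation)"
proof
  show "range (\<lambda>c. fun_scale (*) c augmentation) \<subseteq> HP0_quotient_dual scale \<omega> n"
    using augmentation_dual
    by (auto simp: HP0_dual_def dual_space_def fun_scale_def[of "(*)" _ augmentation] distrib_left mult.left_commute)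
qed (use dual_eq_multiple in blast)

end

theorem theorem1p1p8:
  fixes scale :: "complex \<Rightarrow> 'v::ab_group_add \<Rightarrow> 'v"
    and Basis :: "'v set"
    and \<omega> :: "'v \<Rightarrow> 'v \<Rightarrow> complex"
    and n :: nat
  assumes "finite_dimensional_vector_space scale Basis"
    and "symplectic_form scale \<omega>"
    and "n \<ge> 1"
  shows "(\<exists>T. Vector_Spaces.linear (*) (fun_scale (*)) T \<and>
              bij_betw T (UNIV :: complex set) (HP0_quotient_dual scale \<omega> n)) \<and>
         (\<exists>\<epsilon>\<in>HP0_quotient_dual scale \<omega> n.
              (\<forall>f\<in>invariant_functions scale n. \<epsilon> (HP0_class scale \<omega> n f) = f 0) \<and>
              HP0_quotient_dual scale \<omega> n = module.span (fun_scale (*)) {\<epsilon>})"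
proof -
  interpret finite_dimensional_vector_space scale Basis by fact
  interpret symplectic_space scale Basis \<omega> n
    by standard fact
  let ?T = "\<lambda>c. fun_scale (*) c augmentation"
  \<comment> \<open>A nonzero value of \<open>augmentation\<close> makes \<open>?T\<close>
    injective.\<close>
  have "augmentation (coset (const 1)) = 1"
    by (simp add: augmentation_coset invariant_const) (simp add: const_def)
  then have "inj ?T"
    by (intro injI) (metis fun_scale_def mult.right_neutral)
  then have "bij_betw ?T UNIV (HP0_quotient_dual scale \<omega> n)"
    by (simp add: bij_betw_def dual_eq_range)
  moreover have "Vector_Spaces.linear (*) (fun_scale (*)) ?T"
    using vector_space_fun_scale vector_space_over_itself.vector_space_axioms
    by (auto simp: Vector_Spaces.linear_iff fun_scale_def fun_eq_iff algebra_simps)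
  moreover have "HP0_quotient_dual scale \<omega> n = module.span (fun_scale (*)) {augmentation}"
    by (subst module.span_singleton)
       (simp_all add: dual_eq_range module_iff_vector_space vector_space_fun_scale)
  ultimately show ?thesis
    using augmentation_dual augmentation_coset by blast
qed

end
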